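(* Let $k,l$ be integers with $k \geq 2$ and $0 \leq l \leq 2k-1$. Then there is no planarizing gadget for the class of $(k,l)$-tight graphs; that is, there is no finite graph $\Gamma$ with four distinguished vertices $a,b,c,d$ such that $\Gamma$ has a planar embedding in which $a,c,b,d$ appear on the outer face in this order, and such that for every graph $G$ and every drawing of $G$ in the plane in which two edges $ab$ and $cd$ cross, the graph $G' = G - \{ab,cd\} + \Gamma$ is $(k,l)$-tight if and only if $G$ is $(k,l)$-tight.
   Context: Graphs may be multigraphs. For a graph $G=(V,E)$ and $S \subseteq V$, $E[S]$ denotes the set of edges of $G$ with both endpoints in $S$. For integers $k,l$, a graph $G=(V,E)$ with $|V|=n$, $|E|=m$ is $(k,l)$-sparse if every $S \subseteq V$ with $|S| \geq 2$ satisfies $|E[S]| \leq k|S|-l$; it is $(k,l)$-tight if it is $(k,l)$-sparse and $m = kn-l$. Given a graph $G$ with a drawing in the plane in which edges $ab$ and $cd$ cross, and a graph $\Gamma$ containing distinct vertices $a,b,c,d$, the graph $G' = G - \{ab,cd\} + \Gamma$ is obtained by deleting the edges $ab$ and $cd$ from $G$ and adding a copy of $\Gamma$ whose vertices $a,b,c,d$ are identified with the vertices $a,b,c,d$ of $G$ (all other vertices and all edges of $\Gamma$ being new); in the drawing, the crossing is replaced by $\Gamma$, reducing the number of crossings by one. For a class $L$ of graphs, a graph $\Gamma$ of constant size with a planar embedding in which $a,c,b,d$ appear on the outer face in this order is a planarizing gadget for $L$ if $G \in L \Leftrightarrow G' \in L$ for every such $G$ and drawing. *)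

theory Defs
  imports "HOL-Analysis.Analysis" "HOL-Library.Nat_Bijection"
begin

section \<open>Finite multigraphs and sparsity\<close>

text \<open>Edges are objects of their own, so parallel edges are possible. The set of end points of an
  edge has two elements, or one element if the edge is a loop.\<close>

record ('v, 'e) mgraph =
  verts :: "'v set"
  edges :: "'e set"
  ends :: "'e \<Rightarrow> 'v set"

definition multigraph :: "('v, 'e) mgraph \<Rightarrow> bool" where
  "multigraph G \<longleftrightarrow> finite (verts G) \<and> finite (edges G) \<and>
     (\<forall>e\<in>edges G. ends G e \<subseteq> verts G \<and> card (ends G e) \<in> {1, 2})"

definition loopless :: "('v, 'e) mgraph \<Rightarrow> bool" where
  "loopless G \<longleftrightarrow> (\<forall>e\<in>edges G. card (ends G e) \<noteq> 1)"

definition induced_edges :: "('v, 'e) mgraph \<Rightarrow> 'v set \<Rightarrow> 'e set" where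
  "induced_edges G S = {e \<in> edges G. ends G e \<subseteq> S}"

definition kl_sparse :: "int \<Rightarrow> int \<Rightarrow> ('v, 'e) mgraph \<Rightarrow> bool" where
  "kl_sparse k l G \<longleftrightarrow>
     (\<forall>S \<subseteq> verts G. card S \<ge> 2 \<longrightarrow> int (card (induced_edges G S)) \<le> k * int (card S) - l)"

definition kl_tight :: "int \<Rightarrow> int \<Rightarrow> ('v, 'e) mgraph \<Rightarrow> bool" where
  "kl_tight k l G \<longleftrightarrow>
     kl_sparse k l G \<and> int (card (edges G)) = k * int (card (verts G)) - l"

section \<open>Drawings in the plane\<close>

text \<open>The plane is the type of complex numbers. A drawing of \<open>G\<close> consists of the positions \<open>p\<close> of
  the vertices and a parametrised curve \<open>\<gamma> e\<close> for each edge \<open>e\<close>.\<close>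

definition edge_interior :: "('e \<Rightarrow> real \<Rightarrow> complex) \<Rightarrow> 'e \<Rightarrow> complex set" where
  "edge_interior \<gamma> e = \<gamma> e ` {0<..<1}"

text \<open>The sets \<open>P\<close> and \<open>Q\<close> cross at \<open>z\<close> (rather than touch or overlap): in suitable local coordinates
  at \<open>z\<close> they are the two coordinate axes.\<close>

definition proper_crossing :: "complex set \<Rightarrow> complex set \<Rightarrow> complex \<Rightarrow> bool" where
  "proper_crossing P Q z \<longleftrightarrow>
     (\<exists>U V h h'. open U \<and> z \<in> U \<and> open V \<and> homeomorphism U V h h' \<and> h z = 0 \<and>
        h ` (U \<inter> P) = {w \<in> V. Im w = 0} \<and> h ` (U \<inter> Q) = {w \<in> V. Re w = 0})"

text \<open>For an edge that is not a loop, \<open>simple_path\<close> makes its curve an arc, since the positions of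
  its end points are distinct; for a loop it is a simple closed curve. Edges may cross, also
  repeatedly, but only finitely often, properly, and no three of them in one point.\<close>

definition drawing ::
    "('v, 'e) mgraph \<Rightarrow> ('v \<Rightarrow> complex) \<Rightarrow> ('e \<Rightarrow> real \<Rightarrow> complex) \<Rightarrow> bool" where
  "drawing G p \<gamma> \<longleftrightarrow>
     inj_on p (verts G) \<and>
     (\<forall>e\<in>edges G. simple_path (\<gamma> e) \<and>
        {pathstart (\<gamma> e), pathfinish (\<gamma> e)} = p ` ends G e \<and>
        edge_interior \<gamma> e \<inter> p ` verts G = {}) \<and>
     (\<forall>e\<in>edges G. \<forall>f\<in>edges G. e \<noteq> f \<longrightarrow>
        finite (edge_interior \<gamma> e \<inter> edge_interior \<gamma> f) \<and>
        (\<forall>z \<in> edge_interior \<gamma> e \<inter> edge_interior \<gamma> f.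
           proper_crossing (edge_interior \<gamma> e) (edge_interior \<gamma> f) z)) \<and>
     (\<forall>e\<in>edges G. \<forall>f\<in>edges G. \<forall>g\<in>edges G. e \<noteq> f \<longrightarrow> e \<noteq> g \<longrightarrow> f \<noteq> g \<longrightarrow>
        edge_interior \<gamma> e \<inter> edge_interior \<gamma> f \<inter> edge_interior \<gamma> g = {})"

definition edges_cross :: "('e \<Rightarrow> real \<Rightarrow> complex) \<Rightarrow> 'e \<Rightarrow> 'e \<Rightarrow> bool" where
  "edges_cross \<gamma> e f \<longleftrightarrow>
     (\<exists>z. z \<in> edge_interior \<gamma> e \<inter> edge_interior \<gamma> f \<and>
        proper_crossing (edge_interior \<gamma> e) (edge_interior \<gamma> f) z)"

definition planar_embedding ::
    "('v, 'e) mgraph \<Rightarrow> ('v \<Rightarrow> complex) \<Rightarrow> ('e \<Rightarrow> real \<Rightarrow> complex) \<Rightarrow> bool" where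
  "planar_embedding G p \<gamma> \<longleftrightarrow>
     drawing G p \<gamma> \<and> (\<forall>e\<in>edges G. \<forall>f\<in>edges G. e \<noteq> f \<longrightarrow> \<not> edges_cross \<gamma> e f)"

definition drawing_image ::
    "('v, 'e) mgraph \<Rightarrow> ('v \<Rightarrow> complex) \<Rightarrow> ('e \<Rightarrow> real \<Rightarrow> complex) \<Rightarrow> complex set" where
  "drawing_image G p \<gamma> = p ` verts G \<union> (\<Union>e\<in>edges G. path_image (\<gamma> e))"

text \<open>For an embedded graph, \<open>outside (drawing_image G p \<gamma>)\<close> is the outer face. The boundary of the
  outer face need not be a simple closed curve (the graph may have cut vertices or be disconnected),
  so the order of vertices along it is expressed by a simple closed curve that runs around the
  drawing within the outer face, touching the drawing only in the four vertices. The curve may have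
  either orientation, and the order is cyclic.\<close>

definition on_outer_face_in_order ::
    "('v, 'e) mgraph \<Rightarrow> ('v \<Rightarrow> complex) \<Rightarrow> ('e \<Rightarrow> real \<Rightarrow> complex) \<Rightarrow> 'v \<Rightarrow> 'v \<Rightarrow> 'v \<Rightarrow> 'v \<Rightarrow> bool" where
  "on_outer_face_in_order G p \<gamma> v\<^sub>1 v\<^sub>2 v\<^sub>3 v\<^sub>4 \<longleftrightarrow>
     (\<exists>g s t u. simple_path g \<and> pathfinish g = pathstart g \<and>
        0 < s \<and> s < t \<and> t < u \<and> u < (1::real) \<and>
        g 0 = p v\<^sub>1 \<and> g s = p v\<^sub>2 \<and> g t = p v\<^sub>3 \<and> g u = p v\<^sub>4 \<and>
        path_image g - p ` {v\<^sub>1, v\<^sub>2, v\<^sub>3, v\<^sub>4} \<subseteq> outside (drawing_image G p \<gamma>) \<and>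
        drawing_image G p \<gamma> - p ` {v\<^sub>1, v\<^sub>2, v\<^sub>3, v\<^sub>4} \<subseteq> inside (path_image g))"

section \<open>Planarizing gadgets\<close>

text \<open>\<open>replace_crossing G e f a b c d \<Gamma> a' b' c' d'\<close> is the graph obtained from \<open>G\<close> by deleting the
  edges \<open>e = ab\<close> and \<open>f = cd\<close> and adding a copy of \<open>\<Gamma>\<close> in which the vertices \<open>a', b', c', d'\<close> of \<open>\<Gamma>\<close>
  are identified with \<open>a, b, c, d\<close>. The disjoint union of \<open>G\<close> with the new part of \<open>\<Gamma>\<close> is encoded in
  the natural numbers, so that \<open>G\<close> and the result have the same type and can be members of the same
  class of graphs. Every finite graph is isomorphic to one on natural numbers.\<close>

type_synonym nat_graph = "(nat, nat) mgraph"

definition old :: "nat \<Rightarrow> nat" where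
  "old x = sum_encode (Inl x)"

definition new :: "nat \<Rightarrow> nat" where
  "new x = sum_encode (Inr x)"

definition replace_crossing ::
    "nat_graph \<Rightarrow> nat \<Rightarrow> nat \<Rightarrow> nat \<Rightarrow> nat \<Rightarrow> nat \<Rightarrow> nat \<Rightarrow>
     nat_graph \<Rightarrow> nat \<Rightarrow> nat \<Rightarrow> nat \<Rightarrow> nat \<Rightarrow> nat_graph" where
  "replace_crossing G e f a b c d \<Gamma> a' b' c' d' =
     (let \<phi> = new(a' := old a, b' := old b, c' := old c, d' := old d) in
      \<lparr>verts = old ` verts G \<union> \<phi> ` verts \<Gamma>,
       edges = old ` (edges G - {e, f}) \<union> new ` edges \<Gamma>,
       ends = (\<lambda>x. case sum_decode x of Inl y \<Rightarrow> old ` ends G y | Inr y \<Rightarrow> \<phi> ` ends \<Gamma> y)\<rparr>)"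

text \<open>Here \<open>\<G>\<close> is the collection of all graphs under consideration (multigraphs with or without
  loops, depending on the convention), and \<open>L \<subseteq> \<G>\<close> the class of graphs for which \<open>\<Gamma>\<close> is a gadget.
  The way the drawing of the result arises from that of \<open>G\<close> is not part of the condition, as
  membership in \<open>L\<close> does not depend on it.\<close>

definition planarizing_gadget ::
    "nat_graph set \<Rightarrow> nat_graph set \<Rightarrow> nat_graph \<Rightarrow> nat \<Rightarrow> nat \<Rightarrow> nat \<Rightarrow> nat \<Rightarrow> bool" where
  "planarizing_gadget \<G> L \<Gamma> a b c d \<longleftrightarrow>
     \<Gamma> \<in> \<G> \<and> {a, b, c, d} \<subseteq> verts \<Gamma> \<and> distinct [a, b, c, d] \<and>
     (\<exists>p \<gamma>. planar_embedding \<Gamma> p \<gamma> \<and> on_outer_face_in_order \<Gamma> p \<gamma> a c b d) \<and>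
     (\<forall>G\<in>\<G>. \<forall>p \<gamma>. \<forall>e\<in>edges G. \<forall>f\<in>edges G. \<forall>v w x y.
        drawing G p \<gamma> \<longrightarrow> distinct [v, w, x, y] \<longrightarrow> ends G e = {v, w} \<longrightarrow> ends G f = {x, y} \<longrightarrow>
        edges_cross \<gamma> e f \<longrightarrow>
        (G \<in> L \<longleftrightarrow> replace_crossing G e f v w x y \<Gamma> a b c d \<in> L))"

end

theory Submission
  imports Defs
begin

text \<open>Let \<open>e(S)\<close> be the number of edges of \<open>\<Gamma>\<close> in \<open>S\<close> and \<open>i(S)\<close> the number of vertices in \<open>S\<close> other than
  the terminals \<open>a, b, c, d\<close>. Inserting \<open>\<Gamma>\<close> into a tight graph with suitable tight subsets shows that
  \<open>e(S) \<le> k i(S)\<close> when \<open>S\<close> contains neither \<open>{a, b}\<close> nor \<open>{c, d}\<close>, and \<open>e(S) \<le> k i(S) + 2\<close> always.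
  Inserting \<open>\<Gamma>\<close> into a graph with the right number of edges that is not sparse only because of the
  edge \<open>ab\<close> yields a set \<open>S\<^sub>1\<close> with terminals \<open>a, b\<close> and \<open>e(S\<^sub>1) > k i(S\<^sub>1)\<close>; similarly there is \<open>S\<^sub>2\<close> for
  \<open>c, d\<close>. By supermodularity \<open>X = S\<^sub>1 \<inter> S\<^sub>2\<close> satisfies \<open>e(X) \<ge> k|X|\<close>, and this forces \<open>a\<close> and \<open>b\<close> to be
  connected in \<open>S\<^sub>1 - X\<close>, and \<open>c\<close> and \<open>d\<close> in \<open>S\<^sub>2 - X\<close>. Two disjoint connections of this kind contradict
  planarity, since \<open>a, c, b, d\<close> appear in this order on the outer face.\<close>

section \<open>Disjoint connections in a planar embedding\<close>

text \<open>Counting alone cannot refute a gadget: the two edges ab and cd with no further vertex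
  satisfy all the counts, and only the order on the outer face excludes them. So the counts have to
  yield two connections without a common vertex. Connections in S1 and S2 might meet in X, and
  saturation is what allows X to be removed. It comes out exactly: 2 is the load of the two replaced
  edges, and the two strict integer inequalities for S1 and S2 together gain 2, so that nothing is
  left for X to lose. The test graphs are simple and are drawn in convex position. Every simple
  graph has such a drawing, and there two edges cross as soon as their ends interleave. This removes
  geometry from the counting part, where a test graph is just a set of pairs of numbers.\<close>

lemma simple_path_inj_half_open:
  assumes "simple_path g" "g x = g y" "0 \<le> x" "x < 1" "0 \<le> y" "y < (1::real)"
  shows "x = y"
proof -
  have "x \<in> {0..1}" "y \<in> {0..1}" "x \<noteq> 1" "y \<noteq> 1"
    using assms by auto
  then show ?thesis
    using assms(1,2) unfolding simple_path_def loop_free_def by blast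
qed

text \<open>The arc cuts the inside of the curve into two regions, with \<open>g s\<close> on the
  boundary of one and \<open>g u\<close> on the boundary of the other. The closures of the regions
  would separate a connected set that avoids the arc.\<close>

lemma connected_meets_arc_inside_simple_closed_curve:
  fixes g c :: "real \<Rightarrow> complex"
  assumes g: "simple_path g" "pathfinish g = pathstart g"
    and stu: "0 < s" "s < t" "t < u" "u < (1::real)"
    and c: "arc c" "pathstart c = g 0" "pathfinish c = g t"
    and c_in: "path_image c - {g 0, g t} \<subseteq> inside (path_image g)"
    and K: "connected K" "g s \<in> K" "g u \<in> K" and K_in: "K - {g s, g u} \<subseteq> inside (path_image g)"
  shows "path_image c \<inter> K \<noteq> {}"
proof
  assume cK: "path_image c \<inter> K = {}"
  have g01: "g 1 = g 0"
    using g(2) by (simp add: pathstart_def pathfinish_def)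
  note g_inj = simple_path_inj_half_open[OF g(1)]
  define c1 where "c1 = subpath 0 t g"
  \<comment> \<open>Run backwards from \<open>g 1 = g 0\<close>, so that \<open>c1\<close>,
    \<open>c2\<close> and \<open>c\<close> all lead from \<open>g 0\<close> to \<open>g t\<close>,
    as \<open>split_inside_simple_closed_curve\<close> expects.\<close>
  define c2 where "c2 = subpath 1 t g"
  have g0t: "g 0 \<noteq> g t"
    using g_inj[of 0 t] stu by auto
  have im1: "path_image c1 = g ` {0..t}"
    using stu by (simp add: c1_def path_image_subpath)
  have im2: "path_image c2 = g ` {t..1}"
    using stu by (simp add: c2_def path_image_subpath)
  have im12: "path_image c1 \<union> path_image c2 = path_image g"
  proof -
    have "{0..t} \<union> {t..1} = {0..1}" using stu by auto
    then show ?thesis unfolding im1 im2 by (simp add: path_image_def flip: image_Un)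
  qed
  have eq2: "x = y \<or> (y = 1 \<and> x = 0)" if "g x = g y" "0 \<le> x" "x \<le> t" "t \<le> y" "y \<le> 1" for x y
  proof (cases "y = 1")
    case True
    then have "g x = g 0" using that g01 by simp
    then show ?thesis using True g_inj[of x 0] that stu by simp
  next
    case False
    then show ?thesis using g_inj[of x y] that stu by simp
  qed
  have "path_image c1 \<inter> path_image c2 \<subseteq> {g 0, g t}"
  proof
    fix z assume "z \<in> path_image c1 \<inter> path_image c2"
    then have "z \<in> g ` {0..t}" "z \<in> g ` {t..1}"
      unfolding im1 im2 by auto
    then obtain x y where xy: "z = g x" "z = g y" "0 \<le> x" "x \<le> t" "t \<le> y" "y \<le> 1"
      by (elim imageE) simp
    then have "x = t \<or> x = 0" using eq2[of x y] by auto
    then show "z \<in> {g 0, g t}" using xy(1) by auto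
  qed
  moreover have "{g 0, g t} \<subseteq> path_image c1 \<inter> path_image c2"
    unfolding im1 im2 using stu g01 by (auto intro!: image_eqI[of _ g 1])
  ultimately have c1c2: "path_image c1 \<inter> path_image c2 = {g 0, g t}"
    by blast
  have inside_g: "inside (path_image g) \<inter> path_image g = {}"
    by (simp add: inside_no_overlap)
  have ends_c: "{g 0, g t} \<subseteq> path_image c"
    using c pathstart_in_path_image[of c] pathfinish_in_path_image[of c] by auto
  have c1c: "path_image c1 \<inter> path_image c = {g 0, g t}"
    and c2c: "path_image c2 \<inter> path_image c = {g 0, g t}"
    using ends_c c_in inside_g c1c2 im12 by blast+
  have sp1: "simple_path c1" and sp2: "simple_path c2"
    unfolding c1_def c2_def using g stu g0t g01
    by (auto intro!: simple_path_subpath arc_imp_simple_path arc_simple_path_subpath)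
  \<comment> \<open>A finite connected set has at most one point, so the arc has further points and
    does enter the inside.\<close>
  have "path_image c \<noteq> {g 0, g t}"
  proof
    assume "path_image c = {g 0, g t}"
    then have "finite (path_image c)" by simp
    moreover have "connected (path_image c)"
      using c(1) by (simp add: arc_imp_path connected_path_image)
    ultimately show False
      using connected_finite_iff_sing[of "path_image c"] ends_c g0t by (metis insert_subset singletonD empty_iff)
  qed
  then have ne: "path_image c \<inter> inside (path_image c1 \<union> path_image c2) \<noteq> {}"
    using c_in ends_c unfolding im12 by blast
  define O1 where "O1 = inside (path_image c1 \<union> path_image c)"
  define O2 where "O2 = inside (path_image c2 \<union> path_image c)"
  have disj: "O1 \<inter> O2 = {}"
    and cover: "O1 \<union> O2 \<union> (path_image c - {g 0, g t}) = inside (path_image g)"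
    using split_inside_simple_closed_curve[OF sp1 _ _ sp2 _ _ arc_imp_simple_path[OF c(1)] c(2,3)
        g0t c1c2 c1c c2c ne] g01
    unfolding O1_def O2_def im12 by (auto simp: c1_def c2_def)
  have cl1: "closure O1 \<subseteq> path_image c1 \<union> path_image c \<union> O1"
    and cl2: "closure O2 \<subseteq> path_image c2 \<union> path_image c \<union> O2"
    unfolding O1_def O2_def using sp1 sp2 c(1)
    by (auto intro!: closure_inside_subset closed_Un closed_path_image
        simp: simple_path_imp_path arc_imp_path)
  have gs: "g s \<in> path_image g" "g s \<notin> path_image c2" and gu: "g u \<in> path_image g" "g u \<notin> path_image c1"
  proof -
    show "g s \<in> path_image g" "g u \<in> path_image g"
      using stu by (auto simp: path_image_def)
    show "g s \<notin> path_image c2"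
      unfolding im2 using stu eq2[of s] by fastforce
    show "g u \<notin> path_image c1"
      unfolding im1 using stu eq2[of _ u] by fastforce
  qed
  have gsu: "g s \<noteq> g u"
    using g_inj[of s u] stu by auto
  have sub: "O1 \<subseteq> inside (path_image g)" "O2 \<subseteq> inside (path_image g)"
    using cover by auto
  \<comment> \<open>Closing \<open>O1\<close> adds only points of \<open>c1\<close> and
    \<open>c\<close>. But \<open>K\<close> avoids \<open>c\<close>, and on the curve it has only
    \<open>g s\<close> and \<open>g u\<close>, the latter not on \<open>c1\<close>.\<close>
  have K1: "(closure O1 \<union> {g s}) \<inter> K \<subseteq> O1 \<union> {g s}"
    using cl1 cK K_in inside_g im12 gu by blast
  have K2: "(closure O2 \<union> {g u}) \<inter> K \<subseteq> O2 \<union> {g u}"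
    using cl2 cK K_in inside_g im12 gs by blast
  have "(closure O1 \<union> {g s}) \<inter> (closure O2 \<union> {g u}) \<inter> K = {}"
  proof -
    have "g s \<notin> O2" "g u \<notin> O1"
      using sub gs gu inside_g by blast+
    then have "(O1 \<union> {g s}) \<inter> (O2 \<union> {g u}) = {}"
      using disj gsu by auto
    then show ?thesis using K1 K2 by blast
  qed
  moreover have "K \<subseteq> (closure O1 \<union> {g s}) \<union> (closure O2 \<union> {g u})"
    using K_in cover cK closure_subset[of O1] closure_subset[of O2] by blast
  ultimately have "(closure O1 \<union> {g s}) \<inter> K = {} \<or> (closure O2 \<union> {g u}) \<inter> K = {}"
    by (intro connected_closedD[OF K(1)]) auto
  then show False
    using K(2,3) by auto
qed

section \<open>From connections in a graph to paths in its drawing\<close>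

definition adj_within :: "('v, 'e) mgraph \<Rightarrow> 'v set \<Rightarrow> ('v \<times> 'v) set" where
  "adj_within G A = {(u, v). \<exists>e\<in>edges G. ends G e = {u, v} \<and> ends G e \<subseteq> A}"

definition drawing_part ::
    "('v, 'e) mgraph \<Rightarrow> ('v \<Rightarrow> complex) \<Rightarrow> ('e \<Rightarrow> real \<Rightarrow> complex) \<Rightarrow> 'v set \<Rightarrow> complex set" where
  "drawing_part G p \<gamma> A = p ` A \<union> (\<Union>e\<in>induced_edges G A. path_image (\<gamma> e))"

lemma path_image_eq_edge_interior:
  "path_image (\<gamma> e) = edge_interior \<gamma> e \<union> {pathstart (\<gamma> e), pathfinish (\<gamma> e)}"
proof -
  have "{0..1::real} = {0<..<1} \<union> {0, 1}" by auto
  then show ?thesis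
    unfolding path_image_def edge_interior_def pathstart_def pathfinish_def
    by (simp add: image_Un)
qed

lemma drawing_path_image:
  assumes "drawing G p \<gamma>" "e \<in> edges G"
  shows "path_image (\<gamma> e) = edge_interior \<gamma> e \<union> p ` ends G e"
  using assms path_image_eq_edge_interior[of \<gamma> e] by (simp add: drawing_def)

lemma path_component_drawing_part:
  assumes dr: "drawing G p \<gamma>" and "(u, v) \<in> (adj_within G A)\<^sup>*" "u \<in> A"
  shows "path_component (drawing_part G p \<gamma> A) (p u) (p v) \<and> v \<in> A"
  using assms(2)
proof (induction rule: rtrancl_induct)
  case base
  have "p u \<in> drawing_part G p \<gamma> A" using assms(3) by (simp add: drawing_part_def)
  then show ?case using assms(3) path_component_refl by blast
next
  case (step v w)
  then obtain e where e: "e \<in> edges G" "ends G e = {v, w}" "{v, w} \<subseteq> A"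
    by (auto simp: adj_within_def)
  have sub: "path_image (\<gamma> e) \<subseteq> drawing_part G p \<gamma> A"
    using e by (auto simp: drawing_part_def induced_edges_def)
  have "path (\<gamma> e)"
    using dr e by (auto simp: drawing_def intro: simple_path_imp_path)
  then have "path_component (drawing_part G p \<gamma> A) (pathstart (\<gamma> e)) (pathfinish (\<gamma> e))"
    using sub unfolding path_component_def by blast
  moreover have "{pathstart (\<gamma> e), pathfinish (\<gamma> e)} = {p v, p w}"
    using dr e unfolding drawing_def by (metis image_empty image_insert)
  ultimately have "path_component (drawing_part G p \<gamma> A) (p v) (p w)"
    by (metis doubleton_eq_iff path_component_sym)
  then show ?case using step e path_component_trans by blast
qed

lemma planar_drawing_parts_disjoint:
  assumes pe: "planar_embedding G p \<gamma>" and "A \<inter> B = {}" and AB: "A \<subseteq> verts G" "B \<subseteq> verts G"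
    and ne: "\<And>e. e \<in> edges G \<Longrightarrow> ends G e \<noteq> {}"
  shows "drawing_part G p \<gamma> A \<inter> drawing_part G p \<gamma> B = {}"
proof -
  have dr: "drawing G p \<gamma>" using pe by (simp add: planar_embedding_def)
  have vv: "p ` A \<inter> p ` B = {}"
    using dr assms(2) AB by (auto simp: drawing_def inj_on_def) blast
  have ev: "edge_interior \<gamma> e \<inter> p ` verts G = {}" if "e \<in> edges G" for e
    using dr that by (simp add: drawing_def)
  \<comment> \<open>\<open>planar_embedding\<close> excludes proper crossings only, but in a
    \<open>drawing\<close> every common interior point of two edges is one.\<close>
  have ee: "edge_interior \<gamma> e \<inter> edge_interior \<gamma> f = {}"
    if "e \<in> edges G" "f \<in> edges G" "e \<noteq> f" for e f
    using pe that unfolding planar_embedding_def drawing_def edges_cross_def by (meson equals0I)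
  have part: "drawing_part G p \<gamma> C = p ` C \<union> (\<Union>e\<in>induced_edges G C. edge_interior \<gamma> e)" for C
    using drawing_path_image[OF dr] unfolding drawing_part_def induced_edges_def by fastforce
  \<comment> \<open>An edge without end points would lie in both sets, hence the assumption
    \<open>ne\<close>.\<close>
  have ind: "induced_edges G A \<inter> induced_edges G B = {}"
    using assms(2) ne unfolding induced_edges_def by blast
  have ii: "edge_interior \<gamma> e \<inter> edge_interior \<gamma> f = {}"
    if "e \<in> induced_edges G A" "f \<in> induced_edges G B" for e f
    using ee[of e f] that ind by (auto simp: induced_edges_def)
  have iv: "edge_interior \<gamma> e \<inter> p ` C = {}" if "e \<in> induced_edges G D" "C \<subseteq> verts G" for e C D
    using ev[of e] that by (auto simp: induced_edges_def)
  have "(\<Union>e\<in>induced_edges G A. edge_interior \<gamma> e) \<inter> (\<Union>e\<in>induced_edges G B. edge_interior \<gamma> e) = {}"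
    using ii by blast
  moreover have "p ` A \<inter> (\<Union>e\<in>induced_edges G B. edge_interior \<gamma> e) = {}"
    using iv AB(1) by blast
  moreover have "(\<Union>e\<in>induced_edges G A. edge_interior \<gamma> e) \<inter> p ` B = {}"
    using iv AB(2) by blast
  ultimately show ?thesis
    unfolding part using vv by (simp add: Int_Un_distrib Int_Un_distrib2)
qed

text \<open>The two connections give an arc and a path inside the curve of the outer order. Their
  ends alternate on that curve, so they meet, although the parts of the drawing on \<open>A\<close>
  and \<open>B\<close> are disjoint.\<close>

lemma no_disjoint_connections_if_outer_order:
  assumes G: "multigraph G" and pe: "planar_embedding G p \<gamma>"
    and ord: "on_outer_face_in_order G p \<gamma> a c b d"
    and AB: "A \<subseteq> verts G" "B \<subseteq> verts G" "A \<inter> B = {}"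
    and a: "a \<in> A" "(a, b) \<in> (adj_within G A)\<^sup>*" and c: "c \<in> B" "(c, d) \<in> (adj_within G B)\<^sup>*"
  shows False
proof -
  have dr: "drawing G p \<gamma>" using pe by (simp add: planar_embedding_def)
  obtain g s t u where g: "simple_path g" "pathfinish g = pathstart g"
    and stu: "0 < s" "s < t" "t < u" "u < (1::real)"
    and gv: "g 0 = p a" "g s = p c" "g t = p b" "g u = p d"
    and ins: "drawing_image G p \<gamma> - p ` {a, c, b, d} \<subseteq> inside (path_image g)"
    using ord unfolding on_outer_face_in_order_def by blast
  have ne: "ends G e \<noteq> {}" if "e \<in> edges G" for e
    using G that by (auto simp: multigraph_def)
  define D where "D = drawing_part G p \<gamma>"
  have disj: "D A \<inter> D B = {}"
    unfolding D_def by (rule planar_drawing_parts_disjoint[OF pe AB(3) AB(1,2) ne])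
  have sub: "D C \<subseteq> drawing_image G p \<gamma>" if "C \<subseteq> verts G" for C
    using that unfolding D_def drawing_part_def drawing_image_def induced_edges_def by blast
  have ab: "path_component (D A) (p a) (p b)" "b \<in> A"
    and cd: "path_component (D B) (p c) (p d)" "d \<in> B"
    unfolding D_def using path_component_drawing_part[OF dr] a c by blast+
  have inD: "p ` A \<subseteq> D A" "p ` B \<subseteq> D B"
    by (auto simp: D_def drawing_part_def)
  have "p a \<noteq> p b"
    using simple_path_inj_half_open[OF g(1), of 0 t] stu gv by auto
  obtain h where h: "path h" "path_image h \<subseteq> D A" "pathstart h = p a" "pathfinish h = p b"
    using ab by (auto simp: path_component_def)
  obtain q where q: "arc q" "path_image q \<subseteq> path_image h" "pathstart q = p a" "pathfinish q = p b"
    by (rule path_contains_arc[OF h(1,3,4) \<open>p a \<noteq> p b\<close>])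
  have qA: "path_image q \<subseteq> D A"
    using q(2) h(2) by (rule subset_trans)
  obtain r where r: "path r" "path_image r \<subseteq> D B" "pathstart r = p c" "pathfinish r = p d"
    using cd by (auto simp: path_component_def)
  have "p a \<in> D A" "p b \<in> D A" "p c \<in> D B" "p d \<in> D B"
    using inD a(1) ab(2) c(1) cd(2) by auto
  then have nq: "p c \<notin> path_image q" "p d \<notin> path_image q"
    and nr: "p a \<notin> path_image r" "p b \<notin> path_image r"
    using qA r(2) disj by (meson disjoint_iff subsetD)+
  \<comment> \<open>\<open>ins\<close> excludes all four terminals, so \<open>q\<close> must miss
    \<open>p c\<close> and \<open>p d\<close>; these lie in the other part.\<close>
  have "path_image q - {g 0, g t} \<subseteq> drawing_image G p \<gamma> - p ` {a, c, b, d}"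
    using qA sub[OF AB(1)] nq unfolding gv by auto
  then have "path_image q - {g 0, g t} \<subseteq> inside (path_image g)"
    using ins by (rule subset_trans)
  moreover have "path_image r - {g s, g u} \<subseteq> drawing_image G p \<gamma> - p ` {a, c, b, d}"
    using r(2) sub[OF AB(2)] nr unfolding gv by auto
  then have "path_image r - {g s, g u} \<subseteq> inside (path_image g)"
    using ins by (rule subset_trans)
  moreover have "g s \<in> path_image r" "g u \<in> path_image r"
    using pathstart_in_path_image[of r] pathfinish_in_path_image[of r] by (simp_all add: r gv)
  ultimately have "path_image q \<inter> path_image r \<noteq> {}"
    by (intro connected_meets_arc_inside_simple_closed_curve[OF g stu q(1)] connected_path_image r(1))
      (simp_all add: q gv)
  then show False using disj qA r(2) by blast
qed

section \<open>Straight-line drawings on a parabola\<close>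

text \<open>On a strictly convex curve no vertex lies on the chord of two others, and the order of
  the ends alone decides which chords cross.\<close>

definition parabola :: "real \<Rightarrow> complex" where
  "parabola s = Complex s (s^2)"

definition chord_height :: "real \<Rightarrow> real \<Rightarrow> real \<Rightarrow> real" where
  "chord_height s t x = (s + t) * x - s * t"

definition open_chord :: "real \<Rightarrow> real \<Rightarrow> complex set" where
  "open_chord s t = {z. s < Re z \<and> Re z < t \<and> Im z = chord_height s t (Re z)}"

lemma linepath_parabola_interior:
  assumes "s < t"
  shows "linepath (parabola s) (parabola t) ` {0<..<1} = open_chord s t"
proof (intro equalityI subsetI)
  fix z assume "z \<in> linepath (parabola s) (parabola t) ` {0<..<1}"
  then obtain u where u: "0 < u" "u < 1" "z = linepath (parabola s) (parabola t) u" by auto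
  have re: "Re z = s + u * (t - s)" and im: "Im z = (1 - u) * s^2 + u * t^2"
    unfolding u(3) linepath_def parabola_def by (simp_all add: algebra_simps)
  have "0 < u * (t - s)" "u * (t - s) < 1 * (t - s)"
    using u assms by (auto intro!: mult_strict_right_mono)
  then show "z \<in> open_chord s t"
    by (auto simp: open_chord_def chord_height_def re im algebra_simps power2_eq_square)
next
  fix z assume "z \<in> open_chord s t"
  then have z: "s < Re z" "Re z < t" "Im z = (s + t) * Re z - s * t"
    by (auto simp: open_chord_def chord_height_def)
  define u where "u = (Re z - s) / (t - s)"
  have ru: "Re z = s + u * (t - s)" using assms by (simp add: u_def)
  have "z = linepath (parabola s) (parabola t) u"
    by (rule complex_eqI) (simp_all add: linepath_def parabola_def z(3) ru algebra_simps power2_eq_square)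
  moreover have "0 < u" "u < 1" using z assms by (auto simp: u_def field_simps)
  ultimately show "z \<in> linepath (parabola s) (parabola t) ` {0<..<1}" by auto
qed

lemma chord_height_eq_square_iff: "chord_height s t x = x^2 \<longleftrightarrow> x = s \<or> x = t"
proof -
  have "x^2 - chord_height s t x = (x - s) * (x - t)"
    by (simp add: chord_height_def algebra_simps power2_eq_square)
  then show ?thesis by (metis eq_iff_diff_eq_0 mult_eq_0_iff)
qed

lemma equal_sum_product_cases:
  fixes s t :: real
  assumes "s + t = s' + t'" "s * t = s' * t'"
  shows "s = s' \<and> t = t' \<or> s = t' \<and> t = s'"
proof -
  have "(s - s') * (s - t') = s * s - s * (s' + t') + s' * t'" by (simp add: algebra_simps)
  also have "\<dots> = 0" unfolding assms[symmetric] by (simp add: algebra_simps)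
  finally show ?thesis using assms(1) by auto
qed

lemma chord_intersection_Re:
  assumes "chord_height s t x = chord_height s' t' x" "s + t \<noteq> s' + t'"
  shows "x = (s * t - s' * t') / (s + t - (s' + t'))"
  using assms by (simp add: chord_height_def field_simps)

text \<open>\<open>s + t\<close> is the slope and \<open>- s * t\<close> the intercept of a chord.
  Parallel chords that meet agree in both, and sum and product determine the pair of ends.\<close>

lemma open_chord_meet_sums_noteq:
  assumes "z \<in> open_chord s t" "z \<in> open_chord s' t'" "(s, t) \<noteq> (s', t')"
  shows "s + t \<noteq> s' + t'"
proof
  assume eq: "s + t = s' + t'"
  then have "s * t = s' * t'"
    using assms(1,2) by (auto simp: open_chord_def chord_height_def)
  with eq equal_sum_product_cases[of s t s' t'] show False
    using assms by (auto simp: open_chord_def)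
qed

lemma finite_open_chord_Int:
  assumes "(s, t) \<noteq> (s', t')"
  shows "finite (open_chord s t \<inter> open_chord s' t')"
proof (cases "s + t = s' + t'")
  case True
  then have "open_chord s t \<inter> open_chord s' t' = {}"
    using open_chord_meet_sums_noteq assms by blast
  then show ?thesis by simp
next
  case False
  define x where "x = (s * t - s' * t') / (s + t - (s' + t'))"
  have "open_chord s t \<inter> open_chord s' t' \<subseteq> {Complex x (chord_height s t x)}"
  proof
    fix z assume z: "z \<in> open_chord s t \<inter> open_chord s' t'"
    then have "Re z = x"
      unfolding x_def by (intro chord_intersection_Re[OF _ False]) (auto simp: open_chord_def)
    then show "z \<in> {Complex x (chord_height s t x)}"
      using z by (auto simp: open_chord_def complex_eq_iff)
  qed
  then show ?thesis using finite_subset by blast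
qed

text \<open>The heights above the two lines are affine coordinates in which the first chord lies on
  the real and the second on the imaginary axis. Different slopes make the change of coordinates
  invertible.\<close>

lemma open_chord_proper_crossing:
  assumes zP: "z \<in> open_chord s t" and zQ: "z \<in> open_chord s' t'" and ne: "(s, t) \<noteq> (s', t')"
  shows "proper_crossing (open_chord s t) (open_chord s' t') z"
proof -
  define A where "A = s + t"
  define B where "B = s' + t'"
  have AB: "A \<noteq> B"
    using open_chord_meet_sums_noteq[OF assms] by (simp add: A_def B_def)
  define h where "h w = Complex (Im w - chord_height s' t' (Re w)) (Im w - chord_height s t (Re w))" for w
  \<comment> \<open>The difference of the two heights is affine in \<open>Re w\<close> with slope
    \<open>A - B\<close>; this solves for \<open>Re w\<close>.\<close>
  define X where "X w = (Re w - Im w - s' * t' + s * t) / (A - B)" for w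
  define h' where "h' w = Complex (X w) (Im w + chord_height s t (X w))" for w
  have Xh: "X (h w) = Re w" for w
    using AB by (simp add: X_def h_def chord_height_def A_def B_def field_simps)
  have h'h: "h' (h w) = w" for w
    by (rule complex_eqI) (simp_all add: h'_def Xh, simp add: h_def)
  have "X w * (A - B) = Re w - Im w - s' * t' + s * t" for w
    using AB by (simp add: X_def)
  then have "Im w + chord_height s t (X w) - chord_height s' t' (X w) = Re w" for w
    by (simp add: chord_height_def A_def B_def algebra_simps)
  then have hh': "h (h' w) = w" for w
    by (intro complex_eqI) (simp_all add: h_def h'_def)
  \<comment> \<open>On this strip each chord agrees with its whole line.\<close>
  define U where "U = {w. max s s' < Re w \<and> Re w < min t t'}"
  define V where "V = h' -` U"
  have ch: "continuous_on S h" for S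
    unfolding h_def chord_height_def by (intro continuous_intros)
  have ch': "continuous_on S h'" for S
    unfolding h'_def chord_height_def X_def using AB by (intro continuous_intros) auto
  have opU: "open U"
    unfolding U_def by (intro open_Collect_conj open_Collect_less continuous_intros)
  have opV: "open V"
    unfolding V_def using continuous_on_open_vimage[of UNIV h'] ch' opU by auto
  have hom: "homeomorphism U V h h'"
    unfolding homeomorphism_def using ch ch' h'h hh' by (auto simp: V_def image_iff) metis+
  have "h ` (U \<inter> open_chord s t) = {w \<in> V. Im w = 0}"
  proof (intro equalityI subsetI)
    fix w assume "w \<in> {w \<in> V. Im w = 0}"
    then have "h' w \<in> U \<inter> open_chord s t"
      by (auto simp: V_def U_def open_chord_def h'_def)
    then show "w \<in> h ` (U \<inter> open_chord s t)" using hh'[of w] by (metis imageI)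
  qed (auto simp: V_def h'h, simp add: h_def open_chord_def)
  moreover have "h ` (U \<inter> open_chord s' t') = {w \<in> V. Re w = 0}"
  proof (intro equalityI subsetI)
    fix w assume w: "w \<in> {w \<in> V. Re w = 0}"
    have "Re (h (h' w)) = 0" using w by (simp add: hh')
    then have "Im (h' w) = chord_height s' t' (Re (h' w))" by (simp add: h_def)
    then have "h' w \<in> U \<inter> open_chord s' t'"
      using w by (auto simp: V_def U_def open_chord_def)
    then show "w \<in> h ` (U \<inter> open_chord s' t')" using hh'[of w] by (metis imageI)
  qed (auto simp: V_def h'h, simp add: h_def open_chord_def)
  moreover have "z \<in> U" "h z = 0"
    using zP zQ by (auto simp: U_def open_chord_def h_def complex_eq_iff)
  ultimately show ?thesis
    unfolding proper_crossing_def using opU opV hom by blast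
qed

text \<open>Let \<open>x\<close> be where the two lines meet. Multiplied by the positive difference
  of slopes, \<open>x - s'\<close> and \<open>t - x\<close> become
  \<open>(s' - s) * (t - s')\<close> and \<open>(t' - t) * (t - s')\<close>, so \<open>x\<close>
  lies in the range of both chords.\<close>

lemma interleaved_chords_meet:
  assumes "s < s'" "s' < t" "t < t'"
  shows "open_chord s t \<inter> open_chord s' t' \<noteq> {}"
proof -
  define x where "x = (s' * t' - s * t) / (s' + t' - (s + t))"
  have d: "0 < s' + t' - (s + t)" using assms by simp
  have "s' * t' - s * t - s' * (s' + t' - (s + t)) = (s' - s) * (t - s')"
    by (simp add: algebra_simps)
  moreover have "t * (s' + t' - (s + t)) - (s' * t' - s * t) = (t' - t) * (t - s')"
    by (simp add: algebra_simps)
  ultimately have "s' * (s' + t' - (s + t)) < s' * t' - s * t" "s' * t' - s * t < t * (s' + t' - (s + t))"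
    using assms by (smt (verit) mult_pos_pos)+
  then have x: "s' < x" "x < t"
    using d by (simp_all add: x_def pos_less_divide_eq pos_divide_less_eq)
  have "x * (s' + t' - (s + t)) = s' * t' - s * t" using d by (simp add: x_def)
  then have "chord_height s t x = chord_height s' t' x"
    by (simp add: chord_height_def algebra_simps)
  then have "Complex x (chord_height s t x) \<in> open_chord s t \<inter> open_chord s' t'"
    using x assms by (simp add: open_chord_def)
  then show ?thesis by blast
qed

text \<open>Six different indices suffice, because the interiors of chords with a common end are
  disjoint anyway. Whole lines replace chords, which makes the condition purely algebraic.\<close>

definition no_concurrent_chords :: "(nat \<Rightarrow> real) \<Rightarrow> nat \<Rightarrow> bool" where
  "no_concurrent_chords t n \<longleftrightarrow>
     (\<forall>i j i' j' k l x. {i, j, i', j', k, l} \<subseteq> {..<n} \<longrightarrow> distinct [i, j, i', j', k, l] \<longrightarrow>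
        \<not> (chord_height (t i) (t j) x = chord_height (t i') (t j') x \<and>
           chord_height (t i) (t j) x = chord_height (t k) (t l) x))"

lemma chord_height_commute: "chord_height s t = chord_height t s"
  by (simp add: chord_height_def fun_eq_iff algebra_simps)

text \<open>Given the first points, each crossing of two of their chords and each third point exclude
  just one position of the next point.\<close>

lemma exists_general_parabola_points:
  "\<exists>t. (\<forall>i j. i < j \<longrightarrow> j < n \<longrightarrow> t i < t j) \<and> no_concurrent_chords t n"
proof (induction n)
  case 0
  then show ?case by (simp add: no_concurrent_chords_def)
next
  case (Suc n)
  then obtain t where mono: "\<And>i j. i < j \<Longrightarrow> j < n \<Longrightarrow> t i < t j"
    and nc: "no_concurrent_chords t n" by blast
  define X where "X i j i' j' = (t i * t j - t i' * t j') / (t i + t j - (t i' + t j'))" for i j i' j'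
  \<comment> \<open>That the line through the points at \<open>t m\<close> and \<open>v\<close>
    passes through the crossing at \<open>x = X i j i' j'\<close> is a linear equation for
    \<open>v\<close> with coefficient \<open>x - t m\<close>; these are its solutions.\<close>
  define bad where "bad = (\<lambda>(i, j, i', j', m). (chord_height (t i) (t j) (X i j i' j') - t m * X i j i' j') /
    (X i j i' j' - t m)) ` ({..<n} \<times> {..<n} \<times> {..<n} \<times> {..<n} \<times> {..<n})"
  have "finite (bad \<union> t ` {..<n})" by (simp add: bad_def)
  \<comment> \<open>A value above all of these avoids the bad positions and keeps the sequence
    increasing.\<close>
  then obtain v where v: "\<And>y. y \<in> bad \<union> t ` {..<n} \<Longrightarrow> y < v"
    by (metis bdd_above.unfold bdd_above_finite gt_ex le_less_trans)
  have inj: "t i \<noteq> t j" if "i < n" "j < n" "i \<noteq> j" for i j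
    using mono that by (metis less_irrefl nat_neq_iff)
  have new: "\<not> (chord_height (t i) (t j) x = chord_height (t i') (t j') x \<and>
       chord_height (t i) (t j) x = chord_height (t m) v x)"
    if "{i, j, i', j', m} \<subseteq> {..<n}" "distinct [i, j, i', j', m]" for i j i' j' m x
  proof (intro notI, elim conjE)
    assume eq: "chord_height (t i) (t j) x = chord_height (t i') (t j') x"
      and eqv: "chord_height (t i) (t j) x = chord_height (t m) v x"
    have "t i \<noteq> t i'" "t i \<noteq> t j'" using inj that by auto
    then have "t i + t j \<noteq> t i' + t j'"
      using eq equal_sum_product_cases[of "t i" "t j" "t i'" "t j'"] by (auto simp: chord_height_def)
    then have x: "x = X i j i' j'"
      using chord_intersection_Re[OF eq] by (simp add: X_def)
    have "t m \<noteq> t i" "t m \<noteq> t j" using inj that by auto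
    \<comment> \<open>Otherwise the line through the points at \<open>t i\<close> and
      \<open>t j\<close> would meet the parabola in a third point. So the equation can be solved for
      \<open>v\<close>.\<close>
    have "x \<noteq> t m"
    proof
      assume "x = t m"
      then have "chord_height (t i) (t j) (t m) = (t m)^2"
        using eqv chord_height_eq_square_iff[of "t m" v "t m"] by simp
      then show False using chord_height_eq_square_iff \<open>t m \<noteq> t i\<close> \<open>t m \<noteq> t j\<close> by blast
    qed
    then have "v = (chord_height (t i) (t j) x - t m * x) / (x - t m)"
      unfolding eqv by (simp add: chord_height_def field_simps)
    then have "v = (\<lambda>(i, j, i', j', m). (chord_height (t i) (t j) (X i j i' j') - t m * X i j i' j') /
      (X i j i' j' - t m)) (i, j, i', j', m)"
      by (simp add: x)
    then have "v \<in> bad"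
      unfolding bad_def using that by (elim image_eqI) simp
    then show False using v by blast
  qed
  define t' where "t' = t(n := v)"
  have "t' i < t' j" if "i < j" "j < Suc n" for i j
    using mono[of i j] v[of "t i"] that by (auto simp: t'_def less_Suc_eq)
  moreover have "no_concurrent_chords t' (Suc n)"
    unfolding no_concurrent_chords_def
  proof (intro allI impI)
    fix i j i' j' k l x
    assume ran: "{i, j, i', j', k, l} \<subseteq> {..<Suc n}" and dist: "distinct [i, j, i', j', k, l]"
    let ?H = "\<lambda>i j. chord_height (t' i) (t' j) x"
    have new': "\<not> (?H i j = ?H i' j' \<and> ?H i j = ?H m n)"
      if "{i, j, i', j', m} \<subseteq> {..<n}" "distinct [i, j, i', j', m]" for i j i' j' m
      using new[OF that, of x] that by (auto simp: t'_def)
    have comm: "?H a b = ?H b a" for a b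
      by (simp add: chord_height_commute)
    \<comment> \<open>The condition is symmetric in the three chords, so the one ending at the new
      point can be moved to the third place.\<close>
    consider "{i, j, i', j', k, l} \<subseteq> {..<n}" | "n = i" | "n = j" | "n = i'" | "n = j'" | "n = k" | "n = l"
      using ran by fastforce
    then show "\<not> (?H i j = ?H i' j' \<and> ?H i j = ?H k l)"
    proof cases
      case 1
      then have "t' i = t i" "t' j = t j" "t' i' = t i'" "t' j' = t j'" "t' k = t k" "t' l = t l"
        by (auto simp: t'_def)
      moreover have "\<not> (chord_height (t i) (t j) x = chord_height (t i') (t j') x \<and>
          chord_height (t i) (t j) x = chord_height (t k) (t l) x)"
        using nc[unfolded no_concurrent_chords_def, rule_format, OF 1 dist] .
      ultimately show ?thesis by simp
    next
      case 2
      have "{i', j', k, l, j} \<subseteq> {..<n}" "distinct [i', j', k, l, j]"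
        using ran dist 2 by (simp_all add: less_Suc_eq) (metis+)
      from new'[OF this] show ?thesis
        using 2 comm by metis
    next
      case 3
      have "{i', j', k, l, i} \<subseteq> {..<n}" "distinct [i', j', k, l, i]"
        using ran dist 3 by (simp_all add: less_Suc_eq) (metis+)
      from new'[OF this] show ?thesis
        using 3 comm by metis
    next
      case 4
      have "{i, j, k, l, j'} \<subseteq> {..<n}" "distinct [i, j, k, l, j']"
        using ran dist 4 by (simp_all add: less_Suc_eq) (metis+)
      from new'[OF this] show ?thesis
        using 4 comm by metis
    next
      case 5
      have "{i, j, k, l, i'} \<subseteq> {..<n}" "distinct [i, j, k, l, i']"
        using ran dist 5 by (simp_all add: less_Suc_eq) (metis+)
      from new'[OF this] show ?thesis
        using 5 comm by metis
    next
      case 6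
      have "{i, j, i', j', l} \<subseteq> {..<n}" "distinct [i, j, i', j', l]"
        using ran dist 6 by (simp_all add: less_Suc_eq) (metis+)
      from new'[OF this] show ?thesis
        using 6 comm by metis
    next
      case 7
      have "{i, j, i', j', k} \<subseteq> {..<n}" "distinct [i, j, i', j', k]"
        using ran dist 7 by (simp_all add: less_Suc_eq)
      from new'[OF this] show ?thesis
        using 7 comm by metis
    qed
  qed
  ultimately show ?case by blast
qed

section \<open>Simple graphs and their drawings in convex position\<close>

definition simple_edges :: "nat set \<Rightarrow> nat set set \<Rightarrow> bool" where
  "simple_edges V E \<longleftrightarrow> finite V \<and> (\<forall>X\<in>E. X \<subseteq> V \<and> card X = 2)"

text \<open>Edges have to be numbers. Coding an edge by its set of ends avoids choosing labels and
  makes the map to the ends the same for all graphs.\<close>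

definition simple_graph :: "nat set \<Rightarrow> nat set set \<Rightarrow> nat_graph" where
  "simple_graph V E = \<lparr>verts = V, edges = set_encode ` E, ends = set_decode\<rparr>"

text \<open>As a simp rule it would turn the code \<open>set_encode {v, w}\<close> of an edge into a
  sum of powers of two.\<close>

lemmas [simp del] = set_encode_insert

lemma simple_edges_finite:
  assumes "simple_edges V E"
  shows "finite V" "finite E" "X \<in> E \<Longrightarrow> finite X"
proof -
  show V: "finite V" using assms by (simp add: simple_edges_def)
  have "E \<subseteq> Pow V" using assms by (auto simp: simple_edges_def)
  then show "finite E" using V by (simp add: finite_subset)
  assume "X \<in> E"
  then have "X \<subseteq> V" using assms by (simp add: simple_edges_def)
  then show "finite X" using V by (rule finite_subset)
qed

lemma simple_edges_obtain:
  assumes "simple_edges V E" "X \<in> E"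
  obtains i j where "X = {i, j}" "i < j" "i \<in> V" "j \<in> V"
proof -
  have "card X = 2" "X \<subseteq> V" using assms by (auto simp: simple_edges_def)
  then obtain x y where "X = {x, y}" "x \<noteq> y" "x \<in> V" "y \<in> V" by (auto simp: card_2_iff)
  then show thesis using that[of x y] that[of y x] by (cases "x < y") (auto simp: insert_commute)
qed

definition chord_path :: "(nat \<Rightarrow> real) \<Rightarrow> nat \<Rightarrow> real \<Rightarrow> complex" where
  "chord_path t e = linepath (parabola (t (Min (set_decode e)))) (parabola (t (Max (set_decode e))))"

text \<open>The vertices follow the parabola in the order of their numbers, so interleaved numbers
  force a crossing. Both orders of the two edges are recorded, since either edge may play the part
  of ab.\<close>

lemma simple_graph_drawing:
  assumes VE: "simple_edges V E"
  obtains p \<gamma> where "drawing (simple_graph V E) p \<gamma>"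
    and "\<And>v w x y. {v, w} \<in> E \<Longrightarrow> {x, y} \<in> E \<Longrightarrow> v < x \<Longrightarrow> x < w \<Longrightarrow> w < y \<Longrightarrow>
      edges_cross \<gamma> (set_encode {v, w}) (set_encode {x, y}) \<and>
      edges_cross \<gamma> (set_encode {x, y}) (set_encode {v, w})"
proof -
  obtain n where n: "V \<subseteq> {..<n}"
    using simple_edges_finite(1)[OF VE] finite_nat_iff_bounded by blast
  obtain t where mono: "\<And>i j. i < j \<Longrightarrow> j < n \<Longrightarrow> t i < t j" and nc: "no_concurrent_chords t n"
    using exists_general_parabola_points[of n] by blast
  let ?p = "\<lambda>i. parabola (t i)"
  let ?\<gamma> = "chord_path t"
  have inj: "t i = t j \<longleftrightarrow> i = j" if "i \<in> V" "j \<in> V" for i j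
    using mono[of i j] mono[of j i] that n by (cases i j rule: linorder_cases) auto
  have path: "?\<gamma> (set_encode {i, j}) = linepath (?p i) (?p j)" if "i < j" for i j
    using that by (simp add: chord_path_def set_encode_inverse)
  have int: "edge_interior ?\<gamma> (set_encode {i, j}) = open_chord (t i) (t j)" if "i < j" "j \<in> V" for i j
    using mono[of i j] that n unfolding edge_interior_def path[OF that(1)]
    by (intro linepath_parabola_interior) auto
  have edge: "\<exists>i j. X = {i, j} \<and> i < j \<and> i \<in> V \<and> j \<in> V \<and> t i < t j" if X: "X \<in> E" for X
  proof -
    obtain i j where ij: "X = {i, j}" "i < j" "i \<in> V" "j \<in> V"
      by (rule simple_edges_obtain[OF VE X])
    then have "t i < t j" using mono n by auto
    then show ?thesis using ij by blast
  qed
  have cross: "proper_crossing (edge_interior ?\<gamma> (set_encode X)) (edge_interior ?\<gamma> (set_encode Y)) z"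
    and fin: "finite (edge_interior ?\<gamma> (set_encode X) \<inter> edge_interior ?\<gamma> (set_encode Y))"
    if "X \<in> E" "Y \<in> E" "X \<noteq> Y"
      "z \<in> edge_interior ?\<gamma> (set_encode X) \<inter> edge_interior ?\<gamma> (set_encode Y)" for X Y z
  proof -
    obtain i j where ij: "X = {i, j}" "i < j" "i \<in> V" "j \<in> V" using edge \<open>X \<in> E\<close> by blast
    obtain k l where kl: "Y = {k, l}" "k < l" "k \<in> V" "l \<in> V" using edge \<open>Y \<in> E\<close> by blast
    have "(t i, t j) \<noteq> (t k, t l)" using inj ij kl \<open>X \<noteq> Y\<close> by auto
    then show "proper_crossing (edge_interior ?\<gamma> (set_encode X)) (edge_interior ?\<gamma> (set_encode Y)) z"
      and "finite (edge_interior ?\<gamma> (set_encode X) \<inter> edge_interior ?\<gamma> (set_encode Y))"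
      using open_chord_proper_crossing finite_open_chord_Int that(4) int[of i j] int[of k l] ij kl by simp_all
  qed
  \<comment> \<open>\<open>no_concurrent_chords\<close> treats pairwise disjoint edges only; for the
    other triples two edges share an end and, by this, no interior point.\<close>
  have adj: "edge_interior ?\<gamma> (set_encode X) \<inter> edge_interior ?\<gamma> (set_encode Y) = {}"
    if XY: "X \<in> E" "Y \<in> E" "X \<noteq> Y" "X \<inter> Y \<noteq> {}" for X Y
  proof -
    obtain i j where ij: "X = {i, j}" "i < j" "i \<in> V" "j \<in> V" using edge \<open>X \<in> E\<close> by blast
    obtain k l where kl: "Y = {k, l}" "k < l" "k \<in> V" "l \<in> V" using edge \<open>Y \<in> E\<close> by blast
    obtain a b c where abc: "X = {a, b}" "Y = {a, c}" "b \<noteq> c" "a \<in> V" "b \<in> V" "c \<in> V"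
    proof -
      obtain a where a: "a \<in> X" "a \<in> Y" using XY(4) by blast
      obtain b where b: "X = {a, b}" "b \<in> V" using a(1) ij by blast
      obtain c where c: "Y = {a, c}" "c \<in> V" using a(2) kl by blast
      have "a \<in> V" "b \<noteq> c" using a(1) ij b(1) c(1) XY(3) by auto
      then show thesis using b c by (intro that)
    qed
    have H: "chord_height (t i) (t j) = chord_height (t a) (t b)"
      "chord_height (t k) (t l) = chord_height (t a) (t c)"
      using abc ij kl by (auto simp: doubleton_eq_iff chord_height_commute)
    have "x = t a" if "chord_height (t a) (t b) x = chord_height (t a) (t c) x" for x
    proof -
      have "(t b - t c) * (x - t a) = 0" using that by (simp add: chord_height_def algebra_simps)
      then show ?thesis using inj abc by auto
    qed
    moreover have "chord_height (t a) (t b) (t a) = (t a)^2" by (simp add: chord_height_eq_square_iff)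
    ultimately have "Re z = t a" if "z \<in> open_chord (t i) (t j) \<inter> open_chord (t k) (t l)" for z
      using that H by (auto simp: open_chord_def)
    moreover have "t a = t i \<or> t a = t j" using abc(1) ij(1) by auto
    moreover have "Re z \<noteq> t i \<and> Re z \<noteq> t j" if "z \<in> open_chord (t i) (t j)" for z
      using that by (auto simp: open_chord_def)
    ultimately have "open_chord (t i) (t j) \<inter> open_chord (t k) (t l) = {}"
      by fastforce
    then show ?thesis
      using int ij kl by simp
  qed
  have "drawing (simple_graph V E) ?p ?\<gamma>"
    unfolding drawing_def
  proof (intro conjI ballI impI)
    show "inj_on ?p (verts (simple_graph V E))"
      using inj by (auto simp: inj_on_def simple_graph_def parabola_def)
  next
    fix e assume "e \<in> edges (simple_graph V E)"
    then obtain i j where e: "e = set_encode {i, j}" and ij: "i < j" "i \<in> V" "j \<in> V" "t i < t j"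
      using edge by (auto simp: simple_graph_def) blast
    show "simple_path (?\<gamma> e)"
      unfolding e path[OF ij(1)] using ij(4) by (auto intro!: simple_path_linepath simp: parabola_def)
    show "{pathstart (?\<gamma> e), pathfinish (?\<gamma> e)} = ?p ` ends (simple_graph V E) e"
      unfolding e path[OF ij(1)] by (simp add: simple_graph_def set_encode_inverse)
    show "edge_interior ?\<gamma> e \<inter> ?p ` verts (simple_graph V E) = {}"
    proof -
      have "?p v \<notin> open_chord (t i) (t j)" for v
        using chord_height_eq_square_iff[of "t i" "t j" "t v"] by (auto simp: open_chord_def parabola_def)
      then show ?thesis unfolding e int[OF ij(1,3)] by (auto simp: simple_graph_def)
    qed
  next
    fix e f assume "e \<in> edges (simple_graph V E)" "f \<in> edges (simple_graph V E)" "e \<noteq> f"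
    then obtain X Y where XY: "X \<in> E" "Y \<in> E" "X \<noteq> Y" "e = set_encode X" "f = set_encode Y"
      by (auto simp: simple_graph_def)
    show "finite (edge_interior ?\<gamma> e \<inter> edge_interior ?\<gamma> f)"
      using fin[OF XY(1-3)] XY(4,5) by (metis equals0I finite.emptyI)
    show "proper_crossing (edge_interior ?\<gamma> e) (edge_interior ?\<gamma> f) z"
      if "z \<in> edge_interior ?\<gamma> e \<inter> edge_interior ?\<gamma> f" for z
      using cross[OF XY(1-3)] XY(4,5) that by simp
  next
    fix e f g assume "e \<in> edges (simple_graph V E)" "f \<in> edges (simple_graph V E)"
      "g \<in> edges (simple_graph V E)" "e \<noteq> f" "e \<noteq> g" "f \<noteq> g"
    then obtain X Y Z where XYZ: "X \<in> E" "Y \<in> E" "Z \<in> E" "X \<noteq> Y" "X \<noteq> Z" "Y \<noteq> Z"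
      and efg: "e = set_encode X" "f = set_encode Y" "g = set_encode Z"
      by (auto simp: simple_graph_def)
    show "edge_interior ?\<gamma> e \<inter> edge_interior ?\<gamma> f \<inter> edge_interior ?\<gamma> g = {}"
    proof (cases "X \<inter> Y = {} \<and> X \<inter> Z = {} \<and> Y \<inter> Z = {}")
      case True
      obtain i j where ij: "X = {i, j}" "i < j" "i \<in> V" "j \<in> V" using edge XYZ(1) by blast
      obtain i' j' where ij': "Y = {i', j'}" "i' < j'" "i' \<in> V" "j' \<in> V" using edge XYZ(2) by blast
      obtain k l where kl: "Z = {k, l}" "k < l" "k \<in> V" "l \<in> V" using edge XYZ(3) by blast
      have "{i, j, i', j', k, l} \<subseteq> {..<n}" "distinct [i, j, i', j', k, l]"
        using True ij ij' kl n by auto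
      then have "\<not> (chord_height (t i) (t j) x = chord_height (t i') (t j') x \<and>
          chord_height (t i) (t j) x = chord_height (t k) (t l) x)" for x
        using nc unfolding no_concurrent_chords_def by blast
      then show ?thesis
        unfolding efg using int ij ij' kl by (auto simp: open_chord_def) metis
    next
      case False
      then show ?thesis unfolding efg using adj XYZ by blast
    qed
  qed
  moreover have "edges_cross ?\<gamma> (set_encode {v, w}) (set_encode {x, y}) \<and>
      edges_cross ?\<gamma> (set_encode {x, y}) (set_encode {v, w})"
    if E: "{v, w} \<in> E" "{x, y} \<in> E" and ord: "v < x" "x < w" "w < y" for v w x y
  proof -
    have V: "w \<in> V" "y \<in> V" using E VE by (auto simp: simple_edges_def)
    have "t v < t x" "t x < t w" "t w < t y" using mono ord V n by auto
    then obtain z where "z \<in> open_chord (t v) (t w) \<inter> open_chord (t x) (t y)"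
      using interleaved_chords_meet by blast
    then have z: "z \<in> edge_interior ?\<gamma> (set_encode {v, w}) \<inter> edge_interior ?\<gamma> (set_encode {x, y})"
      using int[of v w] int[of x y] V ord by simp
    have "{v, w} \<noteq> {x, y}" using ord by auto
    then show ?thesis
      unfolding edges_cross_def using z cross[OF E] cross[OF E(2,1)] by (metis IntD1 IntD2 IntI)
  qed
  ultimately show thesis using that by blast
qed

section \<open>Tightness after replacing a crossing\<close>

definition ecount :: "nat set set \<Rightarrow> nat set \<Rightarrow> int" where
  "ecount E S = int (card {X \<in> E. X \<subseteq> S})"

definition gcount :: "('v, 'e) mgraph \<Rightarrow> 'v set \<Rightarrow> int" where
  "gcount G S = int (card (induced_edges G S))"

definition sparse_edges :: "int \<Rightarrow> int \<Rightarrow> nat set \<Rightarrow> nat set set \<Rightarrow> bool" where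
  "sparse_edges k l V E \<longleftrightarrow> (\<forall>S\<subseteq>V. 2 \<le> card S \<longrightarrow> ecount E S \<le> k * int (card S) - l)"

lemma kl_tight_simple_graph_iff:
  assumes VE: "simple_edges V E"
  shows "kl_tight k l (simple_graph V E) \<longleftrightarrow>
    sparse_edges k l V E \<and> ecount E V = k * int (card V) - l"
proof -
  have inj: "inj_on set_encode E"
    using inj_on_subset[OF inj_on_set_encode] simple_edges_finite(3)[OF VE] by blast
  have "induced_edges (simple_graph V E) S = set_encode ` {X \<in> E. X \<subseteq> S}" for S
    using simple_edges_finite(3)[OF VE]
    by (auto simp: induced_edges_def simple_graph_def set_encode_inverse)
  then have "int (card (induced_edges (simple_graph V E) S)) = ecount E S" for S
    using inj by (simp add: ecount_def card_image inj_on_def)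
  moreover have "{X \<in> E. X \<subseteq> V} = E" using VE by (auto simp: simple_edges_def)
  then have "int (card (edges (simple_graph V E))) = ecount E V"
    using inj by (simp add: ecount_def simple_graph_def card_image)
  ultimately show ?thesis
    by (auto simp: kl_tight_def kl_sparse_def sparse_edges_def simple_graph_def)
qed

lemma simple_graph_multigraph_loopless:
  assumes "simple_edges V E"
  shows "multigraph (simple_graph V E)" "loopless (simple_graph V E)"
  using assms simple_edges_finite[OF assms]
  by (auto simp: multigraph_def loopless_def simple_graph_def simple_edges_def set_encode_inverse)

definition same_trace ::
    "nat \<Rightarrow> nat \<Rightarrow> nat \<Rightarrow> nat \<Rightarrow> nat \<Rightarrow> nat \<Rightarrow> nat \<Rightarrow> nat \<Rightarrow> nat set \<Rightarrow> nat set \<Rightarrow> bool" where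
  "same_trace v w x y a b c d W S \<longleftrightarrow>
     (v \<in> W \<longleftrightarrow> a \<in> S) \<and> (w \<in> W \<longleftrightarrow> b \<in> S) \<and> (x \<in> W \<longleftrightarrow> c \<in> S) \<and> (y \<in> W \<longleftrightarrow> d \<in> S)"

text \<open>Tightness of \<open>G - {vw, xy} + \<Gamma>\<close>, where a vertex set of this graph is given by its traces
  \<open>W\<close> on \<open>G\<close> and \<open>S\<close> on \<open>\<Gamma>\<close>, which agree on the terminals.\<close>

definition replacement_tight ::
    "int \<Rightarrow> int \<Rightarrow> nat set \<Rightarrow> nat set set \<Rightarrow> nat \<Rightarrow> nat \<Rightarrow> nat \<Rightarrow> nat \<Rightarrow>
     nat_graph \<Rightarrow> nat \<Rightarrow> nat \<Rightarrow> nat \<Rightarrow> nat \<Rightarrow> bool" where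
  "replacement_tight k l V E v w x y \<Gamma> a b c d \<longleftrightarrow>
     (\<forall>W S. W \<subseteq> V \<longrightarrow> S \<subseteq> verts \<Gamma> \<longrightarrow> same_trace v w x y a b c d W S \<longrightarrow>
        2 \<le> card W + card (S - {a, b, c, d}) \<longrightarrow>
        ecount (E - {{v, w}, {x, y}}) W + gcount \<Gamma> S \<le> k * int (card W + card (S - {a, b, c, d})) - l) \<and>
     ecount (E - {{v, w}, {x, y}}) V + gcount \<Gamma> (verts \<Gamma>) =
       k * int (card V + card (verts \<Gamma> - {a, b, c, d})) - l"

lemma replacement_tight_commute:
  "replacement_tight k l V E w v x y \<Gamma> a b c d \<longleftrightarrow> replacement_tight k l V E v w x y \<Gamma> b a c d"
  "replacement_tight k l V E v w y x \<Gamma> a b c d \<longleftrightarrow> replacement_tight k l V E v w x y \<Gamma> a b d c"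
  "replacement_tight k l V E x y v w \<Gamma> a b c d \<longleftrightarrow> replacement_tight k l V E v w x y \<Gamma> c d a b"
  unfolding replacement_tight_def same_trace_def
  by (simp_all add: insert_commute conj_ac)

lemma old_new_simps [simp]:
  "old u = old u' \<longleftrightarrow> u = u'" "new u = new u' \<longleftrightarrow> u = u'" "old u \<noteq> new u'" "new u' \<noteq> old u"
  "sum_decode (old u) = Inl u" "sum_decode (new u) = Inr u"
  unfolding old_def new_def by (metis sum_encode_inverse sum.inject sum.distinct)+

text \<open>A vertex set of the glued graph amounts to a set in \<open>G\<close> and a set in
  \<Gamma> with the same trace on the terminals. The edge counts add up, while of the vertices of
  \<Gamma> only the inner ones are counted in addition.\<close>

lemma replace_crossing_facts:
  assumes VE: "simple_edges V E" and e: "{v, w} \<in> E" and f: "{x, y} \<in> E"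
    and dist: "distinct [v, w, x, y]"
    and \<Gamma>: "multigraph \<Gamma>" "{a, b, c, d} \<subseteq> verts \<Gamma>" "distinct [a, b, c, d]"
    and G': "G' = replace_crossing (simple_graph V E) (set_encode {v, w}) (set_encode {x, y}) v w x y \<Gamma> a b c d"
  shows "multigraph G'" "loopless \<Gamma> \<Longrightarrow> loopless G'"
    and "kl_tight k l G' \<longleftrightarrow> replacement_tight k l V E v w x y \<Gamma> a b c d"
proof -
  define \<phi> where "\<phi> = new(a := old v, b := old w, c := old x, d := old y)"
  define T where "T = {a, b, c, d}"
  define E0 where "E0 = E - {{v, w}, {x, y}}"
  have finV: "finite V" and finE: "finite E" and finX: "X \<in> E \<Longrightarrow> finite X" for X
    using simple_edges_finite[OF VE] by auto
  have inj_enc: "inj_on set_encode E"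
    using inj_on_subset[OF inj_on_set_encode] finX by blast
  have vV: "{v, w, x, y} \<subseteq> V" using VE e f by (auto simp: simple_edges_def)
  have ends\<Gamma>: "ends \<Gamma> g \<subseteq> verts \<Gamma>" "card (ends \<Gamma> g) \<in> {1, 2}" if "g \<in> edges \<Gamma>" for g
    using \<Gamma>(1) that by (auto simp: multigraph_def)
  have fin\<Gamma>: "finite (verts \<Gamma>)" "finite (edges \<Gamma>)"
    using \<Gamma>(1) by (auto simp: multigraph_def)
  \<comment> \<open>The copy of \<Gamma> is faithful because its terminals go to four different old
    vertices and all else to new ones.\<close>
  have inj_\<phi>: "inj \<phi>"
    using \<Gamma>(3) dist by (auto simp: \<phi>_def inj_def)
  have \<phi>_new: "\<phi> z = new z" if "z \<notin> T" for z
    using that by (auto simp: \<phi>_def T_def)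
  have \<phi>_T: "\<phi> a = old v" "\<phi> b = old w" "\<phi> c = old x" "\<phi> d = old y"
    using \<Gamma>(3) by (auto simp: \<phi>_def)
  have \<phi>_old: "\<phi> z = old u \<longleftrightarrow> z = a \<and> u = v \<or> z = b \<and> u = w \<or> z = c \<and> u = x \<or> z = d \<and> u = y" for z u
    using \<phi>_T \<phi>_new[of z] \<Gamma>(3) unfolding T_def by fastforce
  have "set_encode ` E - {set_encode {v, w}, set_encode {x, y}} = set_encode ` E0"
    using inj_on_image_set_diff[OF inj_enc, of E "{{v, w}, {x, y}}"] e f by (simp add: E0_def)
  then have V': "verts G' = old ` V \<union> \<phi> ` verts \<Gamma>"
    and E': "edges G' = (\<lambda>X. old (set_encode X)) ` E0 \<union> new ` edges \<Gamma>"
    unfolding G' replace_crossing_def Let_def \<phi>_def[symmetric] by (simp_all add: simple_graph_def image_image)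
  have ends_old: "ends G' (old (set_encode X)) = old ` X" if "X \<in> E" for X
    unfolding G' replace_crossing_def Let_def using finX[OF that]
    by (simp add: simple_graph_def set_encode_inverse)
  have ends_new: "ends G' (new g) = \<phi> ` ends \<Gamma> g" for g
    unfolding G' replace_crossing_def Let_def \<phi>_def by simp
  have card_\<phi>: "card (\<phi> ` A) = card A" for A
    using inj_\<phi> by (simp add: card_image inj_on_subset)
  have card_old: "card (old ` A) = card A" for A
    by (simp add: card_image inj_on_def)
  have E0: "X \<in> E0 \<Longrightarrow> X \<in> E \<and> X \<subseteq> V \<and> card X = 2" for X
    using VE by (auto simp: E0_def simple_edges_def)
  have ends': "ends G' g \<subseteq> verts G' \<and>
      (card (ends G' g) = 2 \<or> (\<exists>g'\<in>edges \<Gamma>. card (ends G' g) = card (ends \<Gamma> g')))" if "g \<in> edges G'" for g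
    using that unfolding E' V'
  proof
    assume "g \<in> (\<lambda>X. old (set_encode X)) ` E0"
    then obtain X where "g = old (set_encode X)" "X \<in> E0" by blast
    then show "ends G' g \<subseteq> old ` V \<union> \<phi> ` verts \<Gamma> \<and>
      (card (ends G' g) = 2 \<or> (\<exists>g'\<in>edges \<Gamma>. card (ends G' g) = card (ends \<Gamma> g')))"
      using E0 ends_old card_old by auto
  next
    assume "g \<in> new ` edges \<Gamma>"
    then obtain g' where "g = new g'" "g' \<in> edges \<Gamma>" by blast
    then show "ends G' g \<subseteq> old ` V \<union> \<phi> ` verts \<Gamma> \<and>
      (card (ends G' g) = 2 \<or> (\<exists>g'\<in>edges \<Gamma>. card (ends G' g) = card (ends \<Gamma> g')))"
      using ends_new card_\<phi> ends\<Gamma>(1)[of g'] by auto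
  qed
  have finE0: "finite E0" using finE by (simp add: E0_def)
  show "multigraph G'"
    unfolding multigraph_def
  proof (intro conjI ballI)
    show "finite (verts G')" "finite (edges G')"
      using finV fin\<Gamma> finE0 by (simp_all add: V' E')
    fix g assume "g \<in> edges G'"
    then show "ends G' g \<subseteq> verts G'" "card (ends G' g) \<in> {1, 2}"
      using ends'[of g] ends\<Gamma>(2) by (auto, fastforce)
  qed
  show "loopless G'" if "loopless \<Gamma>"
    unfolding loopless_def
  proof
    fix g assume "g \<in> edges G'"
    then show "card (ends G' g) \<noteq> 1"
      using ends'[of g] that by (auto simp: loopless_def)
  qed
  have tr: "W \<subseteq> V \<and> S \<subseteq> verts \<Gamma> \<and> same_trace v w x y a b c d W S \<Longrightarrow>
      card (old ` W \<union> \<phi> ` S) = card W + card (S - T) \<and>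
      int (card (induced_edges G' (old ` W \<union> \<phi> ` S))) = ecount E0 W + gcount \<Gamma> S" for W S
  proof (elim conjE)
    assume W: "W \<subseteq> V" and S: "S \<subseteq> verts \<Gamma>" and st: "same_trace v w x y a b c d W S"
    have fin: "finite W" "finite S"
      using W S finV fin\<Gamma> by (auto intro: finite_subset)
    have "\<phi> ` (S \<inter> T) \<subseteq> old ` W"
      using st \<phi>_T by (auto simp: T_def same_trace_def)
    then have "old ` W \<union> \<phi> ` S = old ` W \<union> new ` (S - T)"
      using \<phi>_new by (force simp: image_iff)
    moreover have "old ` W \<inter> new ` (S - T) = {}" by auto
    moreover have "card (new ` (S - T)) = card (S - T)"
      by (simp add: card_image inj_on_def)
    ultimately have 1: "card (old ` W \<union> \<phi> ` S) = card W + card (S - T)"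
      using fin by (simp add: card_Un_disjoint card_old)
    have o_in: "old u \<in> old ` W \<union> \<phi> ` S \<longleftrightarrow> u \<in> W" for u
    proof -
      have "u \<in> W" if "old u = \<phi> z" "z \<in> S" for z
        using \<phi>_old[of z u, unfolded that(1)[symmetric]] that(2) st[unfolded same_trace_def] by blast
      moreover have "old u \<in> old ` W \<longleftrightarrow> u \<in> W" by auto
      ultimately show ?thesis by blast
    qed
    have p_in: "\<phi> z \<in> old ` W \<union> \<phi> ` S \<longleftrightarrow> z \<in> S" for z
    proof -
      have "z \<in> S" if "\<phi> z = old u" "u \<in> W" for u
        using \<phi>_old[of z u, THEN iffD1, OF that(1)] that(2) st[unfolded same_trace_def] by blast
      moreover have "\<phi> z \<in> \<phi> ` S \<longleftrightarrow> z \<in> S" using inj_\<phi> by (rule inj_image_mem_iff)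
      ultimately show ?thesis by blast
    qed
    have "induced_edges G' (old ` W \<union> \<phi> ` S) =
        (\<lambda>X. old (set_encode X)) ` {X \<in> E0. X \<subseteq> W} \<union> new ` induced_edges \<Gamma> S" (is "?l = ?r")
    proof -
      define R where "R = old ` W \<union> \<phi> ` S"
      have *: "ends G' (old (set_encode X)) \<subseteq> R \<longleftrightarrow> X \<subseteq> W" if "X \<in> E0" for X
        using o_in ends_old[of X] E0[OF that] by (auto simp: image_subset_iff R_def)
      have **: "ends G' (new g) \<subseteq> R \<longleftrightarrow> ends \<Gamma> g \<subseteq> S" for g
        unfolding ends_new using p_in by (auto simp: image_subset_iff R_def)
      show ?thesis
        unfolding induced_edges_def E' R_def[symmetric] using * ** by blast
    qed
    moreover have "(\<lambda>X. old (set_encode X)) ` {X \<in> E0. X \<subseteq> W} \<inter> new ` induced_edges \<Gamma> S = {}"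
      by auto
    moreover have "inj_on (\<lambda>X. old (set_encode X)) {X \<in> E0. X \<subseteq> W}"
      using inj_enc E0 by (auto simp: inj_on_def)
    moreover have "inj_on new (induced_edges \<Gamma> S)" by (simp add: inj_on_def)
    moreover have "finite (induced_edges \<Gamma> S)" using fin\<Gamma> by (simp add: induced_edges_def)
    ultimately have 2: "card (induced_edges G' (old ` W \<union> \<phi> ` S)) =
        card {X \<in> E0. X \<subseteq> W} + card (induced_edges \<Gamma> S)"
      using finE0 by (simp add: card_Un_disjoint card_image)
    show "card (old ` W \<union> \<phi> ` S) = card W + card (S - T) \<and>
      int (card (induced_edges G' (old ` W \<union> \<phi> ` S))) = ecount E0 W + gcount \<Gamma> S"
      using 1 2 by (simp add: ecount_def gcount_def)
  qed
  \<comment> \<open>The preimages of \<open>R\<close> under \<open>old\<close> and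
    \<open>\<phi>\<close> agree on the terminals, because \<open>\<phi>\<close> sends these to the
    old vertices \<open>v\<close>, \<open>w\<close>, \<open>x\<close>, \<open>y\<close>.\<close>
  have all_sets: "\<exists>W S. W \<subseteq> V \<and> S \<subseteq> verts \<Gamma> \<and> same_trace v w x y a b c d W S \<and> R = old ` W \<union> \<phi> ` S"
    if "R \<subseteq> verts G'" for R
  proof (intro exI conjI)
    show "same_trace v w x y a b c d {u \<in> V. old u \<in> R} {z \<in> verts \<Gamma>. \<phi> z \<in> R}"
      using vV \<Gamma>(2) \<phi>_T by (auto simp: same_trace_def)
    show "R = old ` {u \<in> V. old u \<in> R} \<union> \<phi> ` {z \<in> verts \<Gamma>. \<phi> z \<in> R}"
      using that unfolding V' by auto
  qed auto
  have sub: "old ` W \<union> \<phi> ` S \<subseteq> verts G'" if "W \<subseteq> V" "S \<subseteq> verts \<Gamma>" for W S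
    using that unfolding V' by auto
  have full: "same_trace v w x y a b c d V (verts \<Gamma>)"
    using vV \<Gamma>(2) by (auto simp: same_trace_def)
  have "edges G' = induced_edges G' (old ` V \<union> \<phi> ` verts \<Gamma>)"
    using ends' unfolding V'[symmetric] induced_edges_def by auto
  then have "int (card (edges G')) = ecount E0 V + gcount \<Gamma> (verts \<Gamma>)"
    "card (verts G') = card V + card (verts \<Gamma> - T)"
    using tr[of V "verts \<Gamma>"] full unfolding V' by simp_all
  moreover have "kl_sparse k l G' \<longleftrightarrow> (\<forall>W S. W \<subseteq> V \<longrightarrow> S \<subseteq> verts \<Gamma> \<longrightarrow> same_trace v w x y a b c d W S \<longrightarrow>
        2 \<le> card W + card (S - T) \<longrightarrow>
        ecount E0 W + gcount \<Gamma> S \<le> k * int (card W + card (S - T)) - l)"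
    unfolding kl_sparse_def
  proof (intro iffI allI impI)
    fix W S assume *: "\<forall>R\<subseteq>verts G'. 2 \<le> card R \<longrightarrow> int (card (induced_edges G' R)) \<le> k * int (card R) - l"
      and WS: "W \<subseteq> V" "S \<subseteq> verts \<Gamma>" "same_trace v w x y a b c d W S" "2 \<le> card W + card (S - T)"
    show "ecount E0 W + gcount \<Gamma> S \<le> k * int (card W + card (S - T)) - l"
      using *[rule_format, OF sub[OF WS(1,2)]] tr[of W S] WS by simp
  next
    fix R assume *: "\<forall>W S. W \<subseteq> V \<longrightarrow> S \<subseteq> verts \<Gamma> \<longrightarrow> same_trace v w x y a b c d W S \<longrightarrow>
        2 \<le> card W + card (S - T) \<longrightarrow>
        ecount E0 W + gcount \<Gamma> S \<le> k * int (card W + card (S - T)) - l"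
      and R: "R \<subseteq> verts G'" "2 \<le> card R"
    obtain W S where WS: "W \<subseteq> V" "S \<subseteq> verts \<Gamma>" "same_trace v w x y a b c d W S" "R = old ` W \<union> \<phi> ` S"
      using all_sets[OF R(1)] by blast
    show "int (card (induced_edges G' R)) \<le> k * int (card R) - l"
      using *[rule_format, OF WS(1-3)] tr[of W S] WS R(2) by simp
  qed
  ultimately show "kl_tight k l G' \<longleftrightarrow> replacement_tight k l V E v w x y \<Gamma> a b c d"
    unfolding kl_tight_def replacement_tight_def E0_def T_def by simp
qed

text \<open>The gadget property without geometry: the order \<open>v < x < w < y\<close> guarantees
  a drawing in which the two edges cross.\<close>

definition crossing_preserves_tight :: "int \<Rightarrow> int \<Rightarrow> nat_graph \<Rightarrow> nat \<Rightarrow> nat \<Rightarrow> nat \<Rightarrow> nat \<Rightarrow> bool" where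
  "crossing_preserves_tight k l \<Gamma> a b c d \<longleftrightarrow>
     (\<forall>V E v w x y. simple_edges V E \<longrightarrow> {v, w} \<in> E \<longrightarrow> {x, y} \<in> E \<longrightarrow> v < x \<longrightarrow> x < w \<longrightarrow> w < y \<longrightarrow>
        (sparse_edges k l V E \<and> ecount E V = k * int (card V) - l \<longleftrightarrow>
         replacement_tight k l V E v w x y \<Gamma> a b c d))"

text \<open>The ends of a crossing edge can be named in either order, and the two edges can be
  exchanged. Renaming them in \<open>G\<close> has the same effect on the counts as permuting the
  terminals of \<Gamma>.\<close>

lemma planarizing_gadget_preserves_tight:
  assumes \<G>: "\<G> = {G. multigraph G} \<or> \<G> = {G. multigraph G \<and> loopless G}"
    and gad: "planarizing_gadget \<G> {G \<in> \<G>. kl_tight k l G} \<Gamma> a b c d"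
  shows "crossing_preserves_tight k l \<Gamma> a b c d" "crossing_preserves_tight k l \<Gamma> b a c d"
    "crossing_preserves_tight k l \<Gamma> a b d c" "crossing_preserves_tight k l \<Gamma> b a d c"
    "crossing_preserves_tight k l \<Gamma> c d a b"
proof -
  have \<Gamma>: "multigraph \<Gamma>" "{a, b, c, d} \<subseteq> verts \<Gamma>" "distinct [a, b, c, d]"
    and \<Gamma>\<G>: "\<Gamma> \<in> \<G>"
    using gad \<G> unfolding planarizing_gadget_def by auto
  have main: "kl_tight k l (simple_graph V E) \<longleftrightarrow> replacement_tight k l V E v' w' x' y' \<Gamma> a b c d"
    if VE: "simple_edges V E" and dr: "drawing (simple_graph V E) p \<gamma>"
      and e: "{v', w'} \<in> E" and f: "{x', y'} \<in> E" and dist: "distinct [v', w', x', y']"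
      and cr: "edges_cross \<gamma> (set_encode {v', w'}) (set_encode {x', y'})"
    for V E p \<gamma> v' w' x' y'
  proof -
    let ?G = "simple_graph V E" and ?e = "set_encode {v', w'}" and ?f = "set_encode {x', y'}"
    let ?G' = "replace_crossing ?G ?e ?f v' w' x' y' \<Gamma> a b c d"
    have G: "?G \<in> \<G>"
      using \<G> simple_graph_multigraph_loopless[OF VE] by auto
    note facts = replace_crossing_facts[OF VE e f dist \<Gamma> refl]
    have G': "?G' \<in> \<G>"
      using \<G> facts(1,2) \<Gamma>\<G> by auto
    have "?e \<in> edges ?G" "?f \<in> edges ?G" "ends ?G ?e = {v', w'}" "ends ?G ?f = {x', y'}"
      using e f by (auto simp: simple_graph_def set_encode_inverse)
    then have "?G \<in> {G \<in> \<G>. kl_tight k l G} \<longleftrightarrow> ?G' \<in> {G \<in> \<G>. kl_tight k l G}"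
      using gad G dr dist cr unfolding planarizing_gadget_def by blast
    then show ?thesis using G G' facts(3) by auto
  qed
  have all: "(sparse_edges k l V E \<and> ecount E V = k * int (card V) - l \<longleftrightarrow>
         replacement_tight k l V E v w x y \<Gamma> a b c d) \<and>
      (sparse_edges k l V E \<and> ecount E V = k * int (card V) - l \<longleftrightarrow>
         replacement_tight k l V E v w x y \<Gamma> b a c d) \<and>
      (sparse_edges k l V E \<and> ecount E V = k * int (card V) - l \<longleftrightarrow>
         replacement_tight k l V E v w x y \<Gamma> a b d c) \<and>
      (sparse_edges k l V E \<and> ecount E V = k * int (card V) - l \<longleftrightarrow>
         replacement_tight k l V E v w x y \<Gamma> b a d c) \<and>
      (sparse_edges k l V E \<and> ecount E V = k * int (card V) - l \<longleftrightarrow>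
         replacement_tight k l V E v w x y \<Gamma> c d a b)"
    if VE: "simple_edges V E" and e: "{v, w} \<in> E" and f: "{x, y} \<in> E" and ord: "v < x" "x < w" "w < y"
    for V E v w x y
  proof -
    obtain p \<gamma> where dr: "drawing (simple_graph V E) p \<gamma>"
      and cr: "edges_cross \<gamma> (set_encode {v, w}) (set_encode {x, y})"
        "edges_cross \<gamma> (set_encode {x, y}) (set_encode {v, w})"
      using simple_graph_drawing[OF VE] e f ord by metis
    have comm: "{w, v} = {v, w}" "{y, x} = {x, y}" by auto
    note m = main[OF VE dr, unfolded kl_tight_simple_graph_iff[OF VE]]
    show ?thesis
      using m[of v w x y] m[of w v x y] m[of v w y x] m[of w v y x] m[of x y v w] e f ord cr
      by (simp add: comm replacement_tight_commute)
  qed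
  show "crossing_preserves_tight k l \<Gamma> a b c d" "crossing_preserves_tight k l \<Gamma> b a c d"
    "crossing_preserves_tight k l \<Gamma> a b d c" "crossing_preserves_tight k l \<Gamma> b a d c"
    "crossing_preserves_tight k l \<Gamma> c d a b"
    unfolding crossing_preserves_tight_def by (intro allI impI, use all in blast)+
qed

section \<open>Tight graphs and one nearly tight graph\<close>

definition star :: "nat \<Rightarrow> nat set \<Rightarrow> nat set set" where
  "star z A = (\<lambda>u. {z, u}) ` A"

lemma simple_edges_star:
  assumes "simple_edges V E" "A \<subseteq> V" "z \<notin> V"
  shows "simple_edges (insert z V) (E \<union> star z A)"
proof -
  have "card {z, u} = 2 \<and> {z, u} \<subseteq> insert z V" if "u \<in> A" for u
    using that assms(2,3) by (cases "z = u") auto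
  moreover have "X \<subseteq> insert z V \<and> card X = 2" if "X \<in> E" for X
    using that assms(1) by (auto simp: simple_edges_def)
  ultimately show ?thesis
    using assms(1) by (auto simp: simple_edges_def star_def)
qed

lemma ecount_star:
  assumes VE: "simple_edges V E" and A: "A \<subseteq> V" "z \<notin> V"
  shows "ecount (E \<union> star z A) S = ecount E S + (if z \<in> S then int (card (A \<inter> S)) else 0)"
proof -
  have "{X \<in> star z A. X \<subseteq> S} = (if z \<in> S then (\<lambda>u. {z, u}) ` (A \<inter> S) else {})"
    by (auto simp: star_def)
  moreover have "inj_on (\<lambda>u. {z, u}) (A \<inter> S)" by (auto simp: inj_on_def doubleton_eq_iff)
  ultimately have "card {X \<in> star z A. X \<subseteq> S} = (if z \<in> S then card (A \<inter> S) else 0)"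
    by (simp add: card_image)
  moreover have "{X \<in> E \<union> star z A. X \<subseteq> S} = {X \<in> E. X \<subseteq> S} \<union> {X \<in> star z A. X \<subseteq> S}" by auto
  moreover have "{X \<in> E. X \<subseteq> S} \<inter> {X \<in> star z A. X \<subseteq> S} = {}"
    using VE A by (auto simp: simple_edges_def star_def)
  moreover have "finite {X \<in> star z A. X \<subseteq> S}"
    using finite_subset[OF A(1) simple_edges_finite(1)[OF VE]] by (simp add: star_def)
  ultimately show ?thesis
    using simple_edges_finite(2)[OF VE] by (simp add: ecount_def card_Un_disjoint)
qed

lemma ecount_Int_vertices:
  assumes "simple_edges V E"
  shows "ecount E S = ecount E (S \<inter> V)"
proof -
  have "{X \<in> E. X \<subseteq> S} = {X \<in> E. X \<subseteq> S \<inter> V}" using assms by (auto simp: simple_edges_def)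
  then show ?thesis by (simp add: ecount_def)
qed

lemma ecount_small:
  assumes VE: "simple_edges V E" and "finite S" "card S \<le> 1"
  shows "ecount E S = 0"
proof -
  have "\<not> X \<subseteq> S" if "X \<in> E" for X
    using card_mono[OF \<open>finite S\<close>, of X] VE that assms(3) by (auto simp: simple_edges_def)
  then have none: "{X \<in> E. X \<subseteq> S} = {}" by blast
  show ?thesis unfolding ecount_def none by simp
qed

lemma ecount_remove2:
  assumes "finite E" "X \<in> E" "Y \<in> E" "X \<noteq> Y"
  shows "ecount (E - {X, Y}) S = ecount E S - of_bool (X \<subseteq> S) - of_bool (Y \<subseteq> S)"
proof -
  have "{Z \<in> E. Z \<subseteq> S} = {Z \<in> E - {X, Y}. Z \<subseteq> S} \<union> {Z \<in> {X, Y}. Z \<subseteq> S}" using assms by auto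
  moreover have "card \<dots> = card {Z \<in> E - {X, Y}. Z \<subseteq> S} + card {Z \<in> {X, Y}. Z \<subseteq> S}"
    using assms(1) by (intro card_Un_disjoint) auto
  moreover have "{Z \<in> {X, Y}. Z \<subseteq> S} = (if X \<subseteq> S then {X} else {}) \<union> (if Y \<subseteq> S then {Y} else {})" by auto
  then have "int (card {Z \<in> {X, Y}. Z \<subseteq> S}) = of_bool (X \<subseteq> S) + of_bool (Y \<subseteq> S)"
    using assms(4) by simp
  ultimately show ?thesis by (simp add: ecount_def)
qed

text \<open>A new vertex of degree at most \<open>k\<close> pays for its own edges in every set that
  had two vertices before. A pair of the new vertex and an old one carries at most one edge, which
  is allowed by \<open>l \<le> 2 * k - 1\<close>.\<close>

lemma sparse_edges_star:
  assumes VE: "simple_edges V E" and A: "A \<subseteq> V" "z \<notin> V" and sp: "sparse_edges k l V E"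
    and k: "int (card A) \<le> k" "l \<le> 2 * k - 1"
  shows "sparse_edges k l (insert z V) (E \<union> star z A)"
  unfolding sparse_edges_def
proof (intro allI impI)
  fix S assume S: "S \<subseteq> insert z V" "2 \<le> card S"
  have finS: "finite S" using S(2) by (intro card_ge_0_finite) simp
  have finA: "finite A" using A(1) simple_edges_finite(1)[OF VE] by (rule finite_subset)
  have eq: "ecount E S = ecount E (S - {z})"
    using ecount_Int_vertices[OF VE, of S] ecount_Int_vertices[OF VE, of "S - {z}"] A(2)
    by (simp add: Diff_Int_distrib2)
  have sub: "S - {z} \<subseteq> V" using S by auto
  show "ecount (E \<union> star z A) S \<le> k * int (card S) - l"
  proof (cases "z \<in> S")
    case False
    then have "S \<subseteq> V" using S by auto
    then show ?thesis
      using False S sp ecount_star[OF VE A] by (simp add: sparse_edges_def)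
  next
    case True
    have cS: "card S = Suc (card (S - {z}))" using finS True by (rule card.remove)
    have ec: "ecount (E \<union> star z A) S = ecount E (S - {z}) + int (card (A \<inter> S))"
      using True ecount_star[OF VE A] eq by simp
    show ?thesis
    proof (cases "2 \<le> card (S - {z})")
      case True
      then have "ecount E (S - {z}) \<le> k * int (card (S - {z})) - l"
        using sp sub by (simp add: sparse_edges_def)
      moreover have "card (A \<inter> S) \<le> card A" using finA by (simp add: card_mono)
      ultimately show ?thesis using k ec cS by (simp add: algebra_simps)
    next
      case False
      then have "card (S - {z}) = 1" using S(2) cS by simp
      moreover have "A \<inter> S \<subseteq> S - {z}" using A by auto
      then have "card (A \<inter> S) \<le> card (S - {z})" using finS by (simp add: card_mono)
      moreover have "ecount E (S - {z}) = 0" using ecount_small[OF VE] finS calculation by simp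
      ultimately show ?thesis using k ec cS by simp
    qed
  qed
qed

text \<open>The block is tight for any \<open>L \<le> 2K - 1\<close>: the complete graph on \<open>2K + 1\<close> vertices has
  \<open>K(2K + 1)\<close> edges and induces \<open>s(s - 1)/2 \<le> Ks - (2K - 1)\<close> edges on \<open>s\<close> vertices for
  \<open>2 \<le> s \<le> 2K - 1\<close>; for \<open>s = 2K\<close> all but at most two of the removed path edges count.\<close>

definition path_edges :: "nat \<Rightarrow> nat set set" where
  "path_edges L = (\<lambda>i. {i, Suc i}) ` {..<L}"

definition block :: "nat \<Rightarrow> nat \<Rightarrow> nat set set" where
  "block K L = {X. X \<subseteq> {..<2 * K + 1} \<and> card X = 2} - path_edges L"

lemma simple_edges_block: "simple_edges {..<2 * K + 1} (block K L)"
  by (auto simp: simple_edges_def block_def)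

lemma ecount_block:
  assumes S: "S \<subseteq> {..<2 * K + 1}" and L: "L \<le> 2 * K"
  shows "ecount (block K L) S = int (card S choose 2) - int (card {X \<in> path_edges L. X \<subseteq> S})"
proof -
  have fin: "finite S" using S finite_subset by blast
  have "{X \<in> block K L. X \<subseteq> S} = {X. X \<subseteq> S \<and> card X = 2} - {X \<in> path_edges L. X \<subseteq> S}"
    using S by (auto simp: block_def)
  moreover have sub: "{X \<in> path_edges L. X \<subseteq> S} \<subseteq> {X. X \<subseteq> S \<and> card X = 2}"
    by (auto simp: path_edges_def)
  moreover have "finite {X \<in> path_edges L. X \<subseteq> S}" by (simp add: path_edges_def)
  moreover have "card {X. X \<subseteq> S \<and> card X = 2} = card S choose 2"
    using fin by (rule n_subsets)
  moreover have "card {X \<in> path_edges L. X \<subseteq> S} \<le> card S choose 2"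
    using card_mono[OF _ sub] fin n_subsets[OF fin, of 2] by (simp add: finite_subset)
  ultimately show ?thesis
    by (simp add: ecount_def card_Diff_subset of_nat_diff)
qed

lemma card_path_edges: "card (path_edges L) = L"
proof -
  have "inj_on (\<lambda>i::nat. {i, Suc i}) {..<L}" by (auto simp: inj_on_def doubleton_eq_iff)
  then show ?thesis by (simp add: path_edges_def card_image)
qed

lemma int_choose_two: "2 * int (n choose 2) = int n * (int n - 1)"
proof (cases n)
  case (Suc m)
  have "2 * (Suc m choose 2) = Suc m * m"
    using choose_two[of "Suc m"] by (simp add: even_mult_iff)
  then show ?thesis by (metis Suc add_diff_cancel_left' of_nat_Suc of_nat_mult of_nat_numeral)
qed simp

lemma ecount_block_full:
  assumes "L \<le> 2 * K"
  shows "ecount (block K L) {..<2 * K + 1} = int K * int (2 * K + 1) - int L"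
proof -
  have "{X \<in> path_edges L. X \<subseteq> {..<2 * K + 1}} = path_edges L"
    using assms by (auto simp: path_edges_def)
  then have "ecount (block K L) {..<2 * K + 1} = int ((2 * K + 1) choose 2) - int L"
    using ecount_block[OF subset_refl assms] by (simp only: card_path_edges card_lessThan)
  then show ?thesis
    using int_choose_two[of "2 * K + 1"] by (simp add: algebra_simps)
qed

lemma sparse_edges_block:
  assumes K: "2 \<le> K" and L: "L \<le> 2 * K - 1"
  shows "sparse_edges (int K) (int L) {..<2 * K + 1} (block K L)"
  unfolding sparse_edges_def
proof (intro allI impI)
  fix S assume S: "S \<subseteq> {..<2 * K + 1}" "2 \<le> card S"
  have L': "L \<le> 2 * K" using L by simp
  have c: "card S \<le> 2 * K + 1" using card_mono[OF _ S(1)] by simp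
  note eb = ecount_block[OF S(1) L']
  have ch: "2 * int (card S choose 2) = int (card S) * (int (card S) - 1)"
    by (rule int_choose_two)
  consider "card S = 2 * K + 1" | "card S = 2 * K" | "card S \<le> 2 * K - 1"
    using c by linarith
  then show "ecount (block K L) S \<le> int K * int (card S) - int L"
  proof cases
    case 1
    then have "S = {..<2 * K + 1}" using S(1) by (intro card_subset_eq) auto
    then show ?thesis using ecount_block_full[OF L'] by simp
  next
    case 2
    have "card ({..<2 * K + 1} - S) = 1"
      using 2 S(1) by (subst card_Diff_subset) (auto intro: finite_subset)
    then obtain v where v: "{..<2 * K + 1} - S = {v}" by (auto simp: card_1_singleton_iff)
    \<comment> \<open>A path edge outside \<open>S\<close> contains the missing vertex
      \<open>v\<close>. For \<open>v = 0\<close> the set \<open>{v - 1, v}\<close> is just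
      \<open>{0}\<close>, which is harmless in an upper bound.\<close>
    have "X \<subseteq> S \<or> X = {v, Suc v} \<or> X = {v - 1, v}" if X: "X \<in> path_edges L" for X
    proof -
      obtain i where i: "X = {i, Suc i}" "i < L" using X unfolding path_edges_def by blast
      have "i \<in> S \<or> i = v" "Suc i \<in> S \<or> Suc i = v"
      proof -
        have "i \<in> {..<2 * K + 1}" "Suc i \<in> {..<2 * K + 1}" using i(2) L K by auto
        then show "i \<in> S \<or> i = v" "Suc i \<in> S \<or> Suc i = v" using v by blast+
      qed
      then show ?thesis unfolding i(1) by auto
    qed
    then have sub: "path_edges L \<subseteq> {X \<in> path_edges L. X \<subseteq> S} \<union> {{v, Suc v}, {v - 1, v}}" by blast
    have "L \<le> card ({X \<in> path_edges L. X \<subseteq> S} \<union> {{v, Suc v}, {v - 1, v}})"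
      using card_mono[OF _ sub] by (simp add: card_path_edges) (simp add: path_edges_def)
    also have "\<dots> \<le> card {X \<in> path_edges L. X \<subseteq> S} + card {{v, Suc v}, {v - 1, v}}"
      by (rule card_Un_le)
    also have "card {{v, Suc v}, {v - 1, v}} \<le> 2"
      by (simp add: card_insert_if)
    finally have "int (card {X \<in> path_edges L. X \<subseteq> S}) \<ge> int L - 2" by simp
    moreover have "int (card S choose 2) = int K * (2 * int K - 1)"
      using ch 2 by simp
    \<comment> \<open>The block induces at most two edges more than if the whole removed path lay in
      \<open>S\<close>; \<open>2 \<le> K\<close> makes up for them.\<close>
    ultimately have "ecount (block K L) S \<le> int K * (2 * int K - 1) - int L + 2"
      using eb by simp
    then show ?thesis using 2 K by (simp add: algebra_simps)
  next
    case 3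
    \<comment> \<open>With \<open>s = card S\<close>, the inequality
      \<open>s * (s - 1) / 2 \<le> K * s - (2 * K - 1)\<close> says just that this product is
      nonnegative; equality holds at the sizes 2 and \<open>2 * K - 1\<close>.\<close>
    have "0 \<le> (int (card S) - 2) * (2 * int K - 1 - int (card S))"
      using 3 S(2) K by (intro mult_nonneg_nonneg) auto
    then have "int (card S) * (int (card S) - 1) \<le> 2 * (int K * int (card S) - (2 * int K - 1))"
      by (simp add: algebra_simps)
    then have "ecount (block K L) S \<le> int K * int (card S) - (2 * int K - 1)"
      using eb ch[symmetric] by simp
    then show ?thesis using L K by simp
  qed
qed

section \<open>Edge counts forced on a gadget\<close>

lemma gcount_mono:
  assumes "multigraph G" "S \<subseteq> S'"
  shows "gcount G S \<le> gcount G S'"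
proof -
  have "induced_edges G S \<subseteq> induced_edges G S'" "finite (induced_edges G S')"
    using assms by (auto simp: induced_edges_def multigraph_def)
  then show ?thesis by (simp add: gcount_def card_mono)
qed

lemma gcount_supermodular:
  assumes "multigraph G"
  shows "gcount G A + gcount G B \<le> gcount G (A \<union> B) + gcount G (A \<inter> B)"
proof -
  have fi: "finite (induced_edges G R)" for R
    using assms by (simp add: induced_edges_def multigraph_def)
  have "card (induced_edges G A) + card (induced_edges G B) =
      card (induced_edges G A \<union> induced_edges G B) + card (induced_edges G A \<inter> induced_edges G B)"
    using fi by (intro card_Un_Int)
  also have "induced_edges G A \<inter> induced_edges G B = induced_edges G (A \<inter> B)"
    by (auto simp: induced_edges_def)
  also have "card (induced_edges G A \<union> induced_edges G B) \<le> card (induced_edges G (A \<union> B))"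
    by (intro card_mono fi) (auto simp: induced_edges_def)
  finally show ?thesis by (simp add: gcount_def)
qed

text \<open>Adding the terminals in \<open>T0\<close> to \<open>S\<close> loses no edge and costs no
  vertex, since \<open>W\<close> already counts them. Thus the slack of \<open>W\<close> bounds the
  load of every \<open>S\<close> whose terminals lie in \<open>T0\<close>.\<close>

lemma replacement_tight_bound:
  assumes rt: "replacement_tight k l V E v w x y \<Gamma> a b c d" and \<Gamma>: "multigraph \<Gamma>"
    and T: "{a, b, c, d} \<subseteq> verts \<Gamma>"
    and W: "W \<subseteq> V" "2 \<le> card W" and T0: "same_trace v w x y a b c d W T0" "T0 \<subseteq> {a, b, c, d}"
    and S: "S \<subseteq> verts \<Gamma>" "S \<inter> {a, b, c, d} \<subseteq> T0"
  shows "gcount \<Gamma> S \<le> k * (int (card W) + int (card (S - {a, b, c, d}))) - l - ecount (E - {{v, w}, {x, y}}) W"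
proof -
  have "same_trace v w x y a b c d W (S \<union> T0)"
    using T0 S unfolding same_trace_def by blast
  moreover have "S \<union> T0 \<subseteq> verts \<Gamma>" using T0 T S by blast
  moreover have "S \<union> T0 - {a, b, c, d} = S - {a, b, c, d}" using T0 by blast
  ultimately have "ecount (E - {{v, w}, {x, y}}) W + gcount \<Gamma> (S \<union> T0) \<le>
      k * int (card W + card (S - {a, b, c, d})) - l"
    using rt W unfolding replacement_tight_def by (metis trans_le_add1)
  then show ?thesis
    using gcount_mono[OF \<Gamma>, of S "S \<union> T0"] by simp
qed

lemma card_trace:
  assumes "distinct [a, b, c, d]"
  shows "card (S \<inter> {a, b, c, d}) = of_bool (a \<in> S) + of_bool (b \<in> S) + of_bool (c \<in> S) + of_bool (d \<in> S)"
  using assms by (cases "a \<in> S"; cases "b \<in> S"; cases "c \<in> S"; cases "d \<in> S") simp_all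

text \<open>The test graph is the block with two further vertices \<open>w\<close> and
  \<open>y\<close> of degree \<open>K\<close>, and \<Gamma> replaces the edges \<open>0w\<close> and
  \<open>1y\<close>. Without these the block is still tight, and each of \<open>w\<close> and
  \<open>y\<close> that is added to it creates slack 1. The sets \<open>V\<close>,
  \<open>insert w B\<close>, \<open>insert y B\<close> and \<open>B\<close> yield the bounds with 2,
  1, 1 and 0.\<close>

lemma tight_context_bounds:
  assumes K: "2 \<le> K" and L: "L \<le> 2 * K - 1"
    and \<Gamma>: "multigraph \<Gamma>" and T: "{a, b, c, d} \<subseteq> verts \<Gamma>" and dist: "distinct [a, b, c, d]"
    and cpt: "crossing_preserves_tight (int K) (int L) \<Gamma> a b c d"
  shows "gcount \<Gamma> (verts \<Gamma>) = int K * int (card (verts \<Gamma> - {a, b, c, d})) + 2"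
    and "S \<subseteq> verts \<Gamma> \<Longrightarrow> gcount \<Gamma> S \<le> int K * int (card (S - {a, b, c, d})) + 2"
    and "S \<subseteq> verts \<Gamma> \<Longrightarrow> b \<notin> S \<or> d \<notin> S \<Longrightarrow> gcount \<Gamma> S \<le> int K * int (card (S - {a, b, c, d})) + 1"
    and "S \<subseteq> verts \<Gamma> \<Longrightarrow> b \<notin> S \<Longrightarrow> d \<notin> S \<Longrightarrow> gcount \<Gamma> S \<le> int K * int (card (S - {a, b, c, d}))"
    and "S \<subseteq> verts \<Gamma> \<Longrightarrow> 2 \<le> card S \<Longrightarrow> gcount \<Gamma> S \<le> int K * int (card S) - int L"
proof -
  define B where "B = {..<2 * K + 1}"
  define w where "w = 2 * K + 1"
  define y where "y = 2 * K + 2"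
  define E1 where "E1 = block K L \<union> star w {..<K}"
  define E where "E = E1 \<union> star y {..<K}"
  define V where "V = insert y (insert w B)"
  define H where "H = E - {{0, w}, {1, y}}"
  have L': "L \<le> 2 * K" "int L \<le> 2 * int K - 1" using L K by auto
  have B: "simple_edges B (block K L)" "sparse_edges (int K) (int L) B (block K L)"
    using simple_edges_block sparse_edges_block[OF K L] by (auto simp: B_def)
  have sub1: "{..<K} \<subseteq> B" "w \<notin> B" and sub2: "{..<K} \<subseteq> insert w B" "y \<notin> insert w B"
    by (auto simp: B_def w_def y_def)
  have E1: "simple_edges (insert w B) E1" "sparse_edges (int K) (int L) (insert w B) E1"
    unfolding E1_def
    using simple_edges_star[OF B(1) sub1] sparse_edges_star[OF B(1) sub1 B(2)] L' by auto
  have E: "simple_edges V E" "sparse_edges (int K) (int L) V E"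
    unfolding E_def V_def
    using simple_edges_star[OF E1(1) sub2] sparse_edges_star[OF E1(1) sub2 E1(2)] L' by auto
  have ecE: "ecount E W = ecount (block K L) (W \<inter> B) + (if w \<in> W then int (card ({..<K} \<inter> W)) else 0) +
      (if y \<in> W then int (card ({..<K} \<inter> W)) else 0)" for W
    unfolding E_def ecount_star[OF E1(1) sub2] unfolding E1_def ecount_star[OF B(1) sub1]
    using ecount_Int_vertices[OF B(1), of W] by simp
  have inE: "{0, w} \<in> E" "{1, y} \<in> E"
    using K by (auto simp: E_def E1_def star_def)
  have "{0, w} \<noteq> {1, y}" by (auto simp: w_def y_def doubleton_eq_iff)
  then have ecH: "ecount H W = ecount E W - of_bool ({0, w} \<subseteq> W) - of_bool ({1, y} \<subseteq> W)" for W
    unfolding H_def using ecount_remove2[OF simple_edges_finite(2)[OF E(1)] inE] by simp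
  have eB: "ecount (block K L) B = int K * int (card B) - int L"
    using ecount_block_full[OF L'(1)] by (simp add: B_def)
  have finB: "finite B" by (simp add: B_def)
  have cB: "card B = 2 * K + 1" by (simp add: B_def)
  have ints: "{..<K} \<inter> W = {..<K}" "W \<inter> B = B" if "B \<subseteq> W" for W
    using that sub1 by auto
  have wy: "w \<noteq> y" "w \<notin> B" "y \<notin> B" "0 \<in> B" "1 \<in> B" using K by (auto simp: B_def w_def y_def)
  have BV: "B \<subseteq> V" "B \<subseteq> insert w B" "B \<subseteq> insert y B" by (auto simp: V_def)
  have wV: "w \<in> V" "y \<in> V" "0 \<in> V" "1 \<in> V" and cV: "card V = card B + 2"
    using wy finB by (auto simp: V_def)
  have eV: "ecount E V = int K * int (card V) - int L"
    unfolding ecE ints[OF BV(1)] eB cV using wV by (simp add: algebra_simps)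
  have hV: "ecount H V = int K * int (card V) - int L - 2"
    unfolding ecH eV using wV by simp
  have hB: "ecount H B = int K * int (card B) - int L"
    unfolding ecH ecE ints[OF subset_refl] eB using wy by simp
  have hBw: "ecount H (insert w B) = int K * int (card (insert w B)) - int L - 1"
    unfolding ecH ecE ints[OF BV(2)] eB using wy finB by (auto simp: algebra_simps)
  have hBy: "ecount H (insert y B) = int K * int (card (insert y B)) - int L - 1"
    unfolding ecH ecE ints[OF BV(3)] eB using wy finB by (auto simp: algebra_simps)
  have ord: "(0::nat) < 1" "1 < w" "w < y" using K by (auto simp: w_def y_def)
  have rt: "replacement_tight (int K) (int L) V E 0 w 1 y \<Gamma> a b c d"
    using cpt[unfolded crossing_preserves_tight_def, rule_format, OF E(1) inE ord] E(2) eV by simp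
  note bd = replacement_tight_bound[OF rt \<Gamma> T, folded H_def]
  have fin\<Gamma>: "finite (verts \<Gamma>)" using \<Gamma> by (simp add: multigraph_def)
  show "gcount \<Gamma> (verts \<Gamma>) = int K * int (card (verts \<Gamma> - {a, b, c, d})) + 2"
    using rt hV unfolding replacement_tight_def H_def by (simp add: algebra_simps)
  assume S: "S \<subseteq> verts \<Gamma>"
  have "same_trace 0 w 1 y a b c d V {a, b, c, d}"
    using wy by (simp add: same_trace_def V_def)
  from bd[OF subset_refl _ this subset_refl S] show "gcount \<Gamma> S \<le> int K * int (card (S - {a, b, c, d})) + 2"
    using hV wy finB cB by (simp add: V_def algebra_simps)
  have "same_trace 0 w 1 y a b c d (insert w B) {a, b, c}"
    using wy dist by (simp add: same_trace_def)
  from bd[OF _ _ this _ S] have d: "gcount \<Gamma> S \<le> int K * int (card (S - {a, b, c, d})) + 1" if "d \<notin> S"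
    using hBw wy finB cB that by (auto simp: V_def algebra_simps)
  have "same_trace 0 w 1 y a b c d (insert y B) {a, c, d}"
    using wy dist by (simp add: same_trace_def)
  from bd[OF _ _ this _ S] have b: "gcount \<Gamma> S \<le> int K * int (card (S - {a, b, c, d})) + 1" if "b \<notin> S"
    using hBy wy finB cB that by (auto simp: V_def algebra_simps)
  show "gcount \<Gamma> S \<le> int K * int (card (S - {a, b, c, d})) + 1" if "b \<notin> S \<or> d \<notin> S"
    using b d that by blast
  have "same_trace 0 w 1 y a b c d B {a, c}"
    using wy dist by (simp add: same_trace_def)
  from bd[OF _ _ this _ S] show "gcount \<Gamma> S \<le> int K * int (card (S - {a, b, c, d}))" if "b \<notin> S" "d \<notin> S"
    using hB wy finB cB that K by (auto simp: V_def algebra_simps)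
  show "gcount \<Gamma> S \<le> int K * int (card S) - int L" if "2 \<le> card S"
  proof -
    \<comment> \<open>Exactly the vertices glued to the terminals in \<open>S\<close>, so that the
      glued set has \<open>card S\<close> vertices and contains all edges counted for
      \<open>S\<close>.\<close>
    define W where "W = {u. u = 0 \<and> a \<in> S \<or> u = w \<and> b \<in> S \<or> u = 1 \<and> c \<in> S \<or> u = y \<and> d \<in> S}"
    have dW: "distinct [0, w, 1, y]" using K by (simp add: w_def y_def)
    have st: "same_trace 0 w 1 y a b c d W S"
      using dW by (auto simp: same_trace_def W_def)
    have "W \<inter> {0, w, 1, y} = W" by (auto simp: W_def)
    then have "card W = card (S \<inter> {a, b, c, d})"
      using card_trace[OF dW, of W] card_trace[OF dist, of S] st by (simp add: same_trace_def)
    then have cS: "card W + card (S - {a, b, c, d}) = card S"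
      using finite_subset[OF S fin\<Gamma>] by (metis card_Int_Diff)
    have "W \<subseteq> V" using wy by (auto simp: W_def V_def)
    then have "ecount H W + gcount \<Gamma> S \<le> int K * int (card S) - int L"
      using rt S st cS that unfolding replacement_tight_def H_def by metis
    moreover have "0 \<le> ecount H W" by (simp add: ecount_def)
    ultimately show ?thesis by linarith
  qed
qed

text \<open>The bounds say that \<open>\<Gamma>\<close> puts at most as much load on any terminals as the edges
  \<open>ab\<close> and \<open>cd\<close>, when each inner vertex absorbs \<open>K\<close> edges.\<close>

definition gadget_bounds :: "nat \<Rightarrow> nat \<Rightarrow> nat_graph \<Rightarrow> nat \<Rightarrow> nat \<Rightarrow> nat \<Rightarrow> nat \<Rightarrow> bool" where
  "gadget_bounds K L \<Gamma> a b c d \<longleftrightarrow>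
     gcount \<Gamma> (verts \<Gamma>) = int K * int (card (verts \<Gamma> - {a, b, c, d})) + 2 \<and>
     (\<forall>S\<subseteq>verts \<Gamma>.
        gcount \<Gamma> S \<le> int K * int (card (S - {a, b, c, d})) + 2 \<and>
        (\<not> {a, b, c, d} \<subseteq> S \<longrightarrow> gcount \<Gamma> S \<le> int K * int (card (S - {a, b, c, d})) + 1) \<and>
        (\<not> {a, b} \<subseteq> S \<longrightarrow> \<not> {c, d} \<subseteq> S \<longrightarrow> gcount \<Gamma> S \<le> int K * int (card (S - {a, b, c, d}))) \<and>
        (2 \<le> card S \<longrightarrow> gcount \<Gamma> S \<le> int K * int (card S) - int L))"

lemma gadget_bounds_commute: "gadget_bounds K L \<Gamma> c d a b \<longleftrightarrow> gadget_bounds K L \<Gamma> a b c d"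
proof -
  have "{c, d, a, b} = {a, b, c, d}" by auto
  then show ?thesis unfolding gadget_bounds_def by auto
qed

text \<open>One order of the terminals bounds sets that miss \<open>b\<close> or \<open>d\<close>;
  exchanging \<open>a\<close> with \<open>b\<close> and \<open>c\<close> with \<open>d\<close>
  covers the other missing terminals.\<close>

lemma gadget_boundsI:
  assumes K: "2 \<le> K" and L: "L \<le> 2 * K - 1"
    and \<Gamma>: "multigraph \<Gamma>" and T: "{a, b, c, d} \<subseteq> verts \<Gamma>" and dist: "distinct [a, b, c, d]"
    and cpt: "crossing_preserves_tight (int K) (int L) \<Gamma> a b c d"
      "crossing_preserves_tight (int K) (int L) \<Gamma> b a c d"
      "crossing_preserves_tight (int K) (int L) \<Gamma> a b d c"
      "crossing_preserves_tight (int K) (int L) \<Gamma> b a d c"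
  shows "gadget_bounds K L \<Gamma> a b c d"
proof -
  have eqs: "{b, a, c, d} = {a, b, c, d}" "{a, b, d, c} = {a, b, c, d}" "{b, a, d, c} = {a, b, c, d}"
    by auto
  have T': "{b, a, c, d} \<subseteq> verts \<Gamma>" "{a, b, d, c} \<subseteq> verts \<Gamma>" "{b, a, d, c} \<subseteq> verts \<Gamma>"
    using T by auto
  have dist': "distinct [b, a, c, d]" "distinct [a, b, d, c]" "distinct [b, a, d, c]"
    using dist by auto
  note b0 = tight_context_bounds[OF K L \<Gamma> T dist cpt(1)]
  note b1 = tight_context_bounds[OF K L \<Gamma> T'(1) dist'(1) cpt(2), unfolded eqs]
  note b2 = tight_context_bounds[OF K L \<Gamma> T'(2) dist'(2) cpt(3), unfolded eqs]
  note b3 = tight_context_bounds[OF K L \<Gamma> T'(3) dist'(3) cpt(4), unfolded eqs]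
  show ?thesis
    unfolding gadget_bounds_def
  proof (intro conjI allI impI)
    fix S assume S: "S \<subseteq> verts \<Gamma>"
    show "gcount \<Gamma> S \<le> int K * int (card (S - {a, b, c, d})) + 1" if "\<not> {a, b, c, d} \<subseteq> S"
      using b0(3)[OF S] b3(3)[OF S] that by blast
    show "gcount \<Gamma> S \<le> int K * int (card (S - {a, b, c, d}))" if "\<not> {a, b} \<subseteq> S" "\<not> {c, d} \<subseteq> S"
      using b0(4)[OF S] b1(4)[OF S] b2(4)[OF S] b3(4)[OF S] that by blast
  qed (use b0 in auto)
qed

text \<open>Sparsity speaks of at least two vertices. A smaller \<open>S\<close> is padded to size
  two, which loses no edge.\<close>

lemma gadget_small_union_bound:
  assumes K: "2 \<le> K" and L: "L \<le> 2 * K - 1"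
    and \<Gamma>: "multigraph \<Gamma>" and T: "{a, b, c, d} \<subseteq> verts \<Gamma>" and dist: "distinct [a, b, c, d]"
    and gb: "gadget_bounds K L \<Gamma> a b c d" and S: "S \<subseteq> verts \<Gamma>" and n: "2 \<le> n" "card S \<le> n"
  shows "gcount \<Gamma> S \<le> int K * int n - int L"
proof -
  have fin\<Gamma>: "finite (verts \<Gamma>)" using \<Gamma> by (simp add: multigraph_def)
  have "2 \<le> card (verts \<Gamma>)"
    using card_mono[OF fin\<Gamma> T] dist by simp
  then obtain S' where S': "S \<subseteq> S'" "S' \<subseteq> verts \<Gamma>" "card S' = max 2 (card S)"
    using exists_subset_between[of S "max 2 (card S)" "verts \<Gamma>"] card_mono[OF fin\<Gamma> S] S fin\<Gamma>
    by auto
  have "gcount \<Gamma> S \<le> gcount \<Gamma> S'" using gcount_mono[OF \<Gamma> S'(1)] .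
  also have "\<dots> \<le> int K * int (card S') - int L"
  proof -
    have "2 \<le> card S'" using S'(3) by simp
    then show ?thesis using gb S'(2) unfolding gadget_bounds_def by blast
  qed
  also have "\<dots> \<le> int K * int n - int L"
    using S'(3) n by (simp add: mult_left_mono)
  finally show ?thesis .
qed

text \<open>In the test graph \<open>w\<close> has \<open>K + 1\<close> edges to the block, and the
  adjacent vertices \<open>x\<close> and \<open>y\<close> have \<open>K - 1\<close> each. The total
  \<open>(K + 1) + 2 * (K - 1) + 1 = 3 * K\<close> is right, but the block with \<open>w\<close> has
  one edge too many, because of \<open>0w\<close>. A violation must therefore remain after the
  replacement, and it can only come from a load that \<Gamma> puts on \<open>a\<close> and
  \<open>b\<close>.\<close>

lemma nearly_tight_context_load:
  assumes K: "2 \<le> K" and L: "L \<le> 2 * K - 1"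
    and \<Gamma>: "multigraph \<Gamma>" and T: "{a, b, c, d} \<subseteq> verts \<Gamma>" and dist: "distinct [a, b, c, d]"
    and gb: "gadget_bounds K L \<Gamma> a b c d"
    and cpt: "crossing_preserves_tight (int K) (int L) \<Gamma> a b c d"
  obtains S where "S \<subseteq> verts \<Gamma>" "a \<in> S" "b \<in> S" "c \<notin> S" "d \<notin> S"
    "int K * int (card (S - {a, b, c, d})) < gcount \<Gamma> S"
proof -
  define B where "B = {..<2 * K + 1}"
  \<comment> \<open>Numbered below \<open>w\<close>, so that \<open>0w\<close> and \<open>xy\<close>
    interleave.\<close>
  define x where "x = 2 * K + 1"
  define w where "w = 2 * K + 2"
  define y where "y = 2 * K + 3"
  \<comment> \<open>All three stars leave out 0, so \<open>0w\<close> is a new edge, and in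
    \<open>H\<close> the vertex 0 has no neighbour outside the block.\<close>
  define E1 where "E1 = block K L \<union> star w {1..K}"
  define E2 where "E2 = E1 \<union> star x {1..<K}"
  define H where "H = E2 \<union> star y {1..<K}"
  define V where "V = insert y (insert x (insert w B))"
  define E where "E = insert {0, w} (insert {x, y} H)"
  have L': "L \<le> 2 * K" "int L \<le> 2 * int K - 1" using L K by auto
  have wxy: "0 \<in> B" "w \<notin> B" "x \<notin> B" "y \<notin> B" "distinct [0, w, x, y]"
    using K by (auto simp: B_def w_def x_def y_def)
  have B: "simple_edges B (block K L)" "sparse_edges (int K) (int L) B (block K L)"
    using simple_edges_block sparse_edges_block[OF K L] by (auto simp: B_def)
  have subs: "{1..K} \<subseteq> B" "{1..<K} \<subseteq> insert w B" "{1..<K} \<subseteq> insert x (insert w B)"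
    and notin: "w \<notin> B" "x \<notin> insert w B" "y \<notin> insert x (insert w B)"
    using wxy by (auto simp: B_def)
  have E1: "simple_edges (insert w B) E1" "sparse_edges (int K) (int L) (insert w B) E1"
    unfolding E1_def
    using simple_edges_star[OF B(1) subs(1) notin(1)] sparse_edges_star[OF B(1) subs(1) notin(1) B(2)] L'
    by auto
  have E2: "simple_edges (insert x (insert w B)) E2"
    unfolding E2_def using simple_edges_star[OF E1(1) subs(2) notin(2)] .
  have H: "simple_edges V H"
    unfolding H_def V_def using simple_edges_star[OF E2(1) subs(3) notin(3)] .
  have E: "simple_edges V E"
    using H wxy by (auto simp: simple_edges_def E_def V_def)
  have ecH: "ecount H W = ecount (block K L) (W \<inter> B) + (if w \<in> W then int (card ({1..K} \<inter> W)) else 0) +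
      (if x \<in> W then int (card ({1..<K} \<inter> W)) else 0) + (if y \<in> W then int (card ({1..<K} \<inter> W)) else 0)" for W
    unfolding H_def ecount_star[OF E2(1) subs(3) notin(3)]
    unfolding E2_def ecount_star[OF E1(1) subs(2) notin(2)]
    unfolding E1_def ecount_star[OF B(1) subs(1) notin(1)]
    using ecount_Int_vertices[OF B(1), of W] by simp
  have "{0, w} \<notin> block K L" "{x, y} \<notin> block K L"
    using wxy B(1) by (auto simp: simple_edges_def)
  moreover have "p \<in> A \<or> q \<in> A" if "{p, q} \<in> star u A" for p q u A
    using that by (auto simp: star_def doubleton_eq_iff)
  then have "{0, w} \<notin> star u {1..K}" "{0, w} \<notin> star u {1..<K}"
    "{x, y} \<notin> star u {1..K}" "{x, y} \<notin> star u {1..<K}" for u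
    by (force simp: w_def x_def y_def)+
  ultimately have nH1: "{0, w} \<notin> H" and nH2: "{x, y} \<notin> H"
    by (simp_all add: H_def E2_def E1_def)
  have ne: "{0, w} \<noteq> {x, y}" using wxy by (auto simp: doubleton_eq_iff)
  have EH: "E - {{0, w}, {x, y}} = H" using nH1 nH2 by (auto simp: E_def)
  have inE: "{0, w} \<in> E" "{x, y} \<in> E" by (auto simp: E_def)
  have ecE: "ecount E W = ecount H W + of_bool ({0, w} \<subseteq> W) + of_bool ({x, y} \<subseteq> W)" for W
    using ecount_remove2[OF simple_edges_finite(2)[OF E] inE ne, of W] unfolding EH by simp
  have eB: "ecount (block K L) B = int K * int (card B) - int L"
    using ecount_block_full[OF L'(1)] by (simp add: B_def)
  have finB: "finite B" and cB: "card B = 2 * K + 1" by (simp_all add: B_def)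
  have ints: "{1..K} \<inter> W = {1..K}" "{1..<K} \<inter> W = {1..<K}" "W \<inter> B = B" if "B \<subseteq> W" for W
    using that by (auto simp: B_def)
  have BV: "B \<subseteq> V" "B \<subseteq> insert w B" by (auto simp: V_def)
  have wV: "w \<in> V" "x \<in> V" "y \<in> V" "0 \<in> V" and cV: "card V = card B + 3"
    using wxy finB by (auto simp: V_def)
  have eV: "ecount E V = int K * int (card V) - int L"
    unfolding ecE ecH ints[OF BV(1)] eB cV using wV K by (simp add: algebra_simps of_nat_diff)
  have "int K * int (card (insert w B)) - int L < ecount E (insert w B)"
    unfolding ecE ecH ints[OF BV(2)] eB using wxy finB by (auto simp: algebra_simps)
  moreover have "insert w B \<subseteq> V" "2 \<le> card (insert w B)"
    using finB cB wxy K by (auto simp: V_def)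
  ultimately have "\<not> sparse_edges (int K) (int L) V E"
    unfolding sparse_edges_def by (meson not_le)
  moreover have "0 < x" "x < w" "w < y" by (auto simp: w_def y_def x_def)
  ultimately have nrt: "\<not> replacement_tight (int K) (int L) V E 0 w x y \<Gamma> a b c d"
    using cpt[unfolded crossing_preserves_tight_def, rule_format, OF E inE] by blast
  have hV: "ecount H V = int K * int (card V) - int L - 2"
    using eV ecE[of V] wV by simp
  have "ecount H V + gcount \<Gamma> (verts \<Gamma>) = int K * int (card V + card (verts \<Gamma> - {a, b, c, d})) - int L"
    using hV gb unfolding gadget_bounds_def by (simp add: algebra_simps)
  with nrt obtain W S where W: "W \<subseteq> V" and S: "S \<subseteq> verts \<Gamma>" and st: "same_trace 0 w x y a b c d W S"
    and two: "2 \<le> card W + card (S - {a, b, c, d})"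
    and viol: "int K * int (card W + card (S - {a, b, c, d})) - int L < ecount H W + gcount \<Gamma> S"
    unfolding replacement_tight_def EH by (meson not_le)
  define i where "i = card (S - {a, b, c, d})"
  define Z where "Z = W \<inter> B"
  define z where "z = card Z"
  have tr: "0 \<in> Z \<longleftrightarrow> a \<in> S" "w \<in> W \<longleftrightarrow> b \<in> S" "x \<in> W \<longleftrightarrow> c \<in> S" "y \<in> W \<longleftrightarrow> d \<in> S"
    using st wxy by (auto simp: same_trace_def Z_def)
  have fin: "finite W" "finite Z" "finite S"
    using W S finB \<Gamma> by (auto simp: V_def Z_def multigraph_def intro: finite_subset)
  have "W = Z \<union> (W \<inter> {w, x, y})" using W by (auto simp: V_def Z_def)
  moreover have "Z \<inter> (W \<inter> {w, x, y}) = {}" using wxy by (auto simp: Z_def)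
  ultimately have "card W = z + card (W \<inter> {w, x, y})"
    using fin card_Un_disjoint[of Z "W \<inter> {w, x, y}"] by (simp add: z_def)
  then have cW: "card W = z + of_bool (b \<in> S) + of_bool (c \<in> S) + of_bool (d \<in> S)"
    using wxy(5) tr by (simp add: Int_insert_right)
  have cS: "card S = of_bool (a \<in> S) + of_bool (b \<in> S) + of_bool (c \<in> S) + of_bool (d \<in> S) + i"
    using card_trace[OF dist, of S] card_Int_Diff[OF fin(3), of "{a, b, c, d}"] by (simp add: i_def)
  have iZ: "{1..K} \<inter> W = {1..K} \<inter> Z" "{1..<K} \<inter> W = {1..<K} \<inter> Z"
    using subs(1) by (auto simp: Z_def B_def)
  have bd: "gcount \<Gamma> S \<le> int K * int i + 2"
    "\<not> (a \<in> S \<and> b \<in> S \<and> c \<in> S \<and> d \<in> S) \<Longrightarrow> gcount \<Gamma> S \<le> int K * int i + 1"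
    "\<not> (a \<in> S \<and> b \<in> S) \<Longrightarrow> \<not> (c \<in> S \<and> d \<in> S) \<Longrightarrow> gcount \<Gamma> S \<le> int K * int i"
    using gb S unfolding gadget_bounds_def i_def by simp_all
  \<comment> \<open>Without edges of \<open>H\<close> the violation would contradict the sparsity of
    \<Gamma> itself, as \<open>W\<close> has at least as many vertices as \<open>S\<close> has
    terminals.\<close>
  have h0: "ecount H W \<noteq> 0"
  proof
    assume "ecount H W = 0"
    moreover have "card S \<le> card W + i"
    proof -
      have "a \<in> S \<Longrightarrow> 1 \<le> z" using tr(1) fin(2) card_gt_0_iff[of Z] by (auto simp: z_def Suc_le_eq)
      then show ?thesis unfolding cS cW by (cases "a \<in> S") auto
    qed
    ultimately show False
      using gadget_small_union_bound[OF K L \<Gamma> T dist gb S, of "card W + i"] two viol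
      unfolding i_def[symmetric] by simp
  qed
  have hW: "ecount H W = ecount (block K L) Z + of_bool (b \<in> S) * int (card ({1..K} \<inter> Z)) +
      of_bool (c \<in> S) * int (card ({1..<K} \<inter> Z)) + of_bool (d \<in> S) * int (card ({1..<K} \<inter> Z))"
    unfolding ecH iZ tr Z_def[symmetric] by simp
  \<comment> \<open>With a single block vertex each of \<open>w\<close>, \<open>x\<close>,
    \<open>y\<close> contributes at most one edge, and none if that vertex is 0. This is too little
    for a violation.\<close>
  have "2 \<le> z"
  proof (rule ccontr)
    assume "\<not> 2 \<le> z"
    then have z: "z \<le> 1" by simp
    then have e0: "ecount (block K L) Z = 0"
      using ecount_small[OF B(1) fin(2)] by (simp add: z_def)
    have le1: "card ({1..K} \<inter> Z) \<le> z" "card ({1..<K} \<inter> Z) \<le> z"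
      using fin(2) by (simp_all add: z_def card_mono)
    have "Z \<noteq> {}" using h0 hW e0 by auto
    then have "z \<noteq> 0" using fin(2) by (simp add: z_def)
    then have z1: "z = 1" using z by simp
    have "a \<notin> S"
    proof
      assume "a \<in> S"
      then have "Z = {0}" using tr(1) z1 by (auto simp: z_def card_1_singleton_iff)
      then show False using h0 hW e0 by simp
    qed
    moreover have "ecount H W \<le> of_bool (b \<in> S) + of_bool (c \<in> S) + of_bool (d \<in> S)"
      using hW e0 le1 z1 by auto
    moreover have "0 < ecount H W" using h0 by (simp add: ecount_def)
    ultimately show False
      using viol bd cW z1 L' K unfolding i_def[symmetric]
      by (cases "b \<in> S"; cases "c \<in> S"; cases "d \<in> S") (simp_all add: algebra_simps)
  qed
  then have "ecount (block K L) Z \<le> int K * int z - int L"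
    using B(2) by (simp add: sparse_edges_def Z_def z_def)
  moreover have "card ({1..K} \<inter> Z) \<le> K" "int (card ({1..<K} \<inter> Z)) \<le> int K - 1"
    using card_mono[of "{1..K}" "{1..K} \<inter> Z"] card_mono[of "{1..<K}" "{1..<K} \<inter> Z"] K by auto
  \<comment> \<open>Each of \<open>x\<close> and \<open>y\<close> in \<open>W\<close> falls short of
    \<open>K\<close> edges by one, so the load has to exceed \<open>K * i\<close> by more than the
    number of \<open>c\<close>, \<open>d\<close> in \<open>S\<close>. By \<open>bd\<close> this
    happens only if that number is 0 and \<open>a\<close>, \<open>b\<close> are in
    \<open>S\<close>.\<close>
  ultimately have "a \<in> S \<and> b \<in> S \<and> c \<notin> S \<and> d \<notin> S \<and> int K * int i < gcount \<Gamma> S"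
    using viol hW bd cW unfolding i_def[symmetric]
    by (cases "b \<in> S"; cases "c \<in> S"; cases "d \<in> S"; cases "a \<in> S") (simp_all add: algebra_simps)
  then show thesis using that[OF S] by (simp add: i_def)
qed

section \<open>Disjoint connections in a gadget\<close>

text \<open>If \<open>a\<close> and \<open>b\<close> lay in different components of \<open>S - X\<close>, then each of the two sides, together
  with \<open>X\<close>, would satisfy the bound for vertex sets that miss \<open>a\<close> or \<open>b\<close>. As \<open>X\<close> attains this bound,
  the load on \<open>S\<close> would be too small.\<close>

lemma connected_outside_saturated:
  assumes \<Gamma>: "multigraph \<Gamma>" and S: "S \<subseteq> verts \<Gamma>" "a \<in> S" "b \<in> S"
    and X: "X \<subseteq> S" "X \<inter> T = {}" "k * int (card X) \<le> gcount \<Gamma> X"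
    and T: "a \<in> T" "b \<in> T"
    and bd: "\<And>R. R \<subseteq> S \<Longrightarrow> \<not> {a, b} \<subseteq> R \<Longrightarrow> gcount \<Gamma> R \<le> k * int (card (R - T))"
    and load: "k * int (card (S - T)) < gcount \<Gamma> S"
  shows "(a, b) \<in> (adj_within \<Gamma> (S - X))\<^sup>*"
proof (rule ccontr)
  assume nab: "(a, b) \<notin> (adj_within \<Gamma> (S - X))\<^sup>*"
  have fin: "finite S" "finite (edges \<Gamma>)"
    using \<Gamma> S by (auto simp: multigraph_def intro: finite_subset)
  define A where "A = {u \<in> S - X. (a, u) \<in> (adj_within \<Gamma> (S - X))\<^sup>*}"
  define C where "C = S - X - A"
  \<comment> \<open>No edge joins \<open>A\<close> to \<open>C\<close>, since \<open>A\<close> is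
    closed under adjacency within \<open>S - X\<close>.\<close>
  have sub: "induced_edges \<Gamma> S \<subseteq> induced_edges \<Gamma> (A \<union> X) \<union> induced_edges \<Gamma> (C \<union> X)"
  proof
    fix g assume g: "g \<in> induced_edges \<Gamma> S"
    then have gE: "g \<in> edges \<Gamma>" and gS: "ends \<Gamma> g \<subseteq> S" by (auto simp: induced_edges_def)
    have "card (ends \<Gamma> g) = 1 \<or> card (ends \<Gamma> g) = 2" using \<Gamma> gE by (auto simp: multigraph_def)
    then obtain u u' where u: "ends \<Gamma> g = {u, u'}"
      by (metis card_1_singletonE card_2_iff insert_absorb2)
    have step: "v' \<in> A" if "v \<in> A" "v' \<in> S - X" "ends \<Gamma> g = {v, v'}" for v v'
    proof -
      have "(v, v') \<in> adj_within \<Gamma> (S - X)"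
        using that gE by (auto simp: adj_within_def A_def)
      then show ?thesis using that(1,2) by (auto simp: A_def intro: rtrancl_into_rtrancl)
    qed
    have "ends \<Gamma> g \<subseteq> A \<union> X \<or> ends \<Gamma> g \<subseteq> C \<union> X"
      using step[of u u'] step[of u' u] u gS unfolding C_def by (auto simp: insert_commute)
    then show "g \<in> induced_edges \<Gamma> (A \<union> X) \<union> induced_edges \<Gamma> (C \<union> X)"
      using gE by (auto simp: induced_edges_def)
  qed
  have fi: "finite (induced_edges \<Gamma> R)" for R
    using fin by (simp add: induced_edges_def)
  have "card (induced_edges \<Gamma> S) \<le> card (induced_edges \<Gamma> (A \<union> X) \<union> induced_edges \<Gamma> (C \<union> X))"
    using fi by (intro card_mono sub) simp
  \<comment> \<open>The two sides share exactly \<open>X\<close>, whose edges are counted twice;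
    saturation says that there are enough of them.\<close>
  moreover have "induced_edges \<Gamma> (A \<union> X) \<inter> induced_edges \<Gamma> (C \<union> X) = induced_edges \<Gamma> X"
    by (auto simp: induced_edges_def C_def)
  ultimately have "gcount \<Gamma> S + gcount \<Gamma> X \<le> gcount \<Gamma> (A \<union> X) + gcount \<Gamma> (C \<union> X)"
    using card_Un_Int[OF fi fi, of "A \<union> X" "C \<union> X"] by (simp add: gcount_def)
  moreover have "gcount \<Gamma> (A \<union> X) \<le> k * int (card (A \<union> X - T))"
  proof (rule bd)
    show "\<not> {a, b} \<subseteq> A \<union> X" using nab X T by (auto simp: A_def)
  qed (use X in \<open>auto simp: A_def\<close>)
  moreover have "gcount \<Gamma> (C \<union> X) \<le> k * int (card (C \<union> X - T))"
  proof (rule bd)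
    show "\<not> {a, b} \<subseteq> C \<union> X" using X T S by (auto simp: A_def C_def)
  qed (use X in \<open>auto simp: C_def\<close>)
  moreover have "k * int (card (A \<union> X - T)) + k * int (card (C \<union> X - T)) =
      k * int (card (S - T)) + k * int (card X)"
  proof -
    have "card (A \<union> X - T) + card (C \<union> X - T) =
        card ((A \<union> X - T) \<union> (C \<union> X - T)) + card ((A \<union> X - T) \<inter> (C \<union> X - T))"
      using fin(1) X(1) by (intro card_Un_Int) (auto simp: A_def C_def intro: finite_subset)
    also have "(A \<union> X - T) \<union> (C \<union> X - T) = S - T"
      using X by (auto simp: A_def C_def)
    also have "(A \<union> X - T) \<inter> (C \<union> X - T) = X"
      using X by (auto simp: A_def C_def)
    finally show ?thesis by (metis distrib_left of_nat_add)
  qed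
  ultimately show False using load X(3) by linarith
qed

theorem theorem1:
  fixes k l :: int and \<G> :: "nat_graph set"
  assumes "k \<ge> 2" and "0 \<le> l" and "l \<le> 2 * k - 1"
    and "\<G> = {G. multigraph G} \<or> \<G> = {G. multigraph G \<and> loopless G}"
  shows "\<not> (\<exists>\<Gamma> a b c d. planarizing_gadget \<G> {G \<in> \<G>. kl_tight k l G} \<Gamma> a b c d)"
proof
  assume "\<exists>\<Gamma> a b c d. planarizing_gadget \<G> {G \<in> \<G>. kl_tight k l G} \<Gamma> a b c d"
  then obtain \<Gamma> a b c d where gad: "planarizing_gadget \<G> {G \<in> \<G>. kl_tight k l G} \<Gamma> a b c d"
    by blast
  have \<Gamma>: "multigraph \<Gamma>" and T: "{a, b, c, d} \<subseteq> verts \<Gamma>" and dist: "distinct [a, b, c, d]"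
    using gad assms(4) unfolding planarizing_gadget_def by auto
  obtain p \<gamma> where pe: "planar_embedding \<Gamma> p \<gamma>" and ord: "on_outer_face_in_order \<Gamma> p \<gamma> a c b d"
    using gad unfolding planarizing_gadget_def by blast
  \<comment> \<open>The test graphs are built from natural numbers, and both parameters are
    nonnegative.\<close>
  obtain K L where k: "k = int K" and l: "l = int L"
    using assms(1,2) by (metis nonneg_int_cases order_trans zero_le_numeral)
  have K: "2 \<le> K" and L: "L \<le> 2 * K - 1"
    using assms(1,3) k l by auto
  note cpt = planarizing_gadget_preserves_tight[OF assms(4) gad, unfolded k l]
  have gb: "gadget_bounds K L \<Gamma> a b c d"
    by (rule gadget_boundsI[OF K L \<Gamma> T dist cpt(1-4)])
  have T_eq: "{c, d, a, b} = {a, b, c, d}" by auto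
  define i where "i S = int (card (S - {a, b, c, d}))" for S
  obtain S1 where S1: "S1 \<subseteq> verts \<Gamma>" "a \<in> S1" "b \<in> S1" "c \<notin> S1" "d \<notin> S1"
      "int K * i S1 < gcount \<Gamma> S1"
    unfolding i_def by (rule nearly_tight_context_load[OF K L \<Gamma> T dist gb cpt(1)])
  have "gadget_bounds K L \<Gamma> c d a b" "{c, d, a, b} \<subseteq> verts \<Gamma>" "distinct [c, d, a, b]"
    using gb T dist by (auto simp: gadget_bounds_commute)
  then obtain S2 where S2: "S2 \<subseteq> verts \<Gamma>" "c \<in> S2" "d \<in> S2" "a \<notin> S2" "b \<notin> S2"
      "int K * i S2 < gcount \<Gamma> S2"
    unfolding i_def T_eq[symmetric] using nearly_tight_context_load[OF K L \<Gamma> _ _ _ cpt(5)] by metis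
  define X where "X = S1 \<inter> S2"
  have fin: "finite S1" "finite S2"
    using \<Gamma> S1 S2 by (auto simp: multigraph_def intro: finite_subset)
  have XT: "X \<inter> {a, b, c, d} = {}" using S1 S2 by (auto simp: X_def)
  have "gcount \<Gamma> (S1 \<union> S2) \<le> int K * i (S1 \<union> S2) + 2"
    using gb S1 S2 unfolding gadget_bounds_def i_def by simp
  \<comment> \<open>Inclusion and exclusion for inner vertices; all of \<open>X\<close> is inner, as
    \<open>S1\<close> and \<open>S2\<close> have no common terminal.\<close>
  moreover have "i S1 + i S2 = i (S1 \<union> S2) + int (card X)"
  proof -
    let ?T = "{a, b, c, d}"
    have "card (S1 - ?T) + card (S2 - ?T) = card ((S1 - ?T) \<union> (S2 - ?T)) + card ((S1 - ?T) \<inter> (S2 - ?T))"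
      using fin by (intro card_Un_Int) auto
    also have "(S1 - ?T) \<union> (S2 - ?T) = S1 \<union> S2 - ?T" by auto
    also have "(S1 - ?T) \<inter> (S2 - ?T) = X" using XT by (auto simp: X_def)
    finally show ?thesis by (simp add: i_def)
  qed
  then have "int K * i S1 + int K * i S2 = int K * i (S1 \<union> S2) + int K * int (card X)"
    by (metis distrib_left)
  ultimately have X: "int K * int (card X) \<le> gcount \<Gamma> X"
    using gcount_supermodular[OF \<Gamma>, of S1 S2] S1(6) S2(6) unfolding X_def by linarith
  \<comment> \<open>Subsets of \<open>S1\<close> never contain \<open>{c, d}\<close> and subsets of
    \<open>S2\<close> never contain \<open>{a, b}\<close>, so missing one end of the other pair is
    enough.\<close>
  have bd: "gcount \<Gamma> R \<le> int K * i R" if "R \<subseteq> verts \<Gamma>" "\<not> {a, b} \<subseteq> R" "\<not> {c, d} \<subseteq> R" for R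
    using gb that unfolding gadget_bounds_def i_def by blast
  have "(a, b) \<in> (adj_within \<Gamma> (S1 - X))\<^sup>*"
  proof (rule connected_outside_saturated[OF \<Gamma> S1(1-3) _ XT X])
    show "gcount \<Gamma> R \<le> int K * int (card (R - {a, b, c, d}))" if "R \<subseteq> S1" "\<not> {a, b} \<subseteq> R" for R
      using bd[of R] that S1 unfolding i_def by blast
  qed (use S1 in \<open>auto simp: i_def X_def\<close>)
  moreover have "(c, d) \<in> (adj_within \<Gamma> (S2 - X))\<^sup>*"
  proof (rule connected_outside_saturated[OF \<Gamma> S2(1-3) _ XT X])
    show "gcount \<Gamma> R \<le> int K * int (card (R - {a, b, c, d}))" if "R \<subseteq> S2" "\<not> {c, d} \<subseteq> R" for R
      using bd[of R] that S2 unfolding i_def by blast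
  qed (use S2 in \<open>auto simp: i_def X_def\<close>)
  moreover have "a \<in> S1 - X" "c \<in> S2 - X" "(S1 - X) \<inter> (S2 - X) = {}"
    using S1 S2 by (auto simp: X_def)
  ultimately show False
    using no_disjoint_connections_if_outer_order[OF \<Gamma> pe ord, of "S1 - X" "S2 - X"] S1(1) S2(1) by blast
qed

end
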